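(* Let $\Gamma\curvearrowright(X,\nu)$ be a measure-class-preserving action of a countable discrete group on a probability space. The action is asymptotically expanding in measure if and only if every domain $Y\subseteq X$ admits an exhaustion by domains of Markov expansion.
   Context: Actions are measurable; measure-class-preserving means that measure-zero sets are sent to measure-zero sets. A domain is a measurable subset of $X$ of positive finite measure. An exhaustion of $Y$ is a nested sequence of measurable subsets $Y_1\subseteq Y_2\subseteq\cdots\subseteq Y$ with $\bigcup_n Y_n=Y$ up to measure zero. Asymptotic expansion: the action is asymptotically expanding (in measure) if for every $\alpha\in(0,\frac12]$ there are a constant $c_\alpha>0$ and a finite symmetric set $S_\alpha\subseteq\Gamma$ such that $\nu\big(\bigcup_{s\in S_\alpha}s\cdot A\big)>(1+c_\alpha)\nu(A)$ for every measurable $A\subseteq X$ with $\alpha\leq\nu(A)\leq\frac12$. (Equivalently, one may take $S_\alpha$ to be the ball of radius $k(\alpha)\in\mathbb{N}$ around the identity for a fixed proper length function on $\Gamma$.) Markov expansion: let $r(\gamma,x):=\frac{d\gamma^{-1}_*\nu}{d\nu}(x)$. Let $S\subseteq\Gamma$ be finite, symmetric, with $1\in S$, and let $Y\subseteq X$ be a domain. For $x\in Y$ put $S_{Y,x}:=\{s\in S: s\cdot x\in Y\}$ and $\sigma_{Y,S}(x):=\sum_{s\in S_{Y,x}}r(s,x)^{1/2}$. The normalised local Markov kernel on $Y$ is $$\Pi_{Y,S}(x,\cdot):=\frac{1}{\sigma_{Y,S}(x)}\sum_{s\in S_{Y,x}}r(s,x)^{1/2}\,\delta_{s\cdot x},$$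 and $\tilde\nu_{Y,S}$ is the measure on $Y$ with $d\tilde\nu_{Y,S}:=\sigma_{Y,S}\,d(\nu|_Y)$. For measurable $A\subseteq Y$ let $|\partial_{\Pi_{Y,S}}(A)|:=\int_A\Pi_{Y,S}(x,Y\setminus A)\,d\tilde\nu_{Y,S}(x)$. $Y$ is a domain of Markov $S$-expansion if the Cheeger constant $\inf\{|\partial_{\Pi_{Y,S}}(A)|/\tilde\nu_{Y,S}(A) : A\subseteq Y \text{ measurable},\ 0<\tilde\nu_{Y,S}(A)\leq\frac12\tilde\nu_{Y,S}(Y)\}$ is strictly positive. $Y$ is a domain of Markov expansion if it is a domain of Markov $S$-expansion for some finite symmetric $S\subseteq\Gamma$ with $1\in S$. *)

theory Defs
  imports "HOL-Probability.Probability" "HOL-Algebra.Group_Action"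
begin

(* A measurable action of a discrete group: every element acts measurably. In the library's
   group_action each map \<phi> g is extensional, so its values outside space M are irrelevant. *)
definition measure_class_preserving_action ::
  "('g, 'h) monoid_scheme \<Rightarrow> 'a measure \<Rightarrow> ('g \<Rightarrow> 'a \<Rightarrow> 'a) \<Rightarrow> bool" where
  "measure_class_preserving_action G M \<phi> \<longleftrightarrow>
     group_action G (space M) \<phi> \<and>
     (\<forall>g\<in>carrier G. \<phi> g \<in> measurable M M) \<and>
     (\<forall>g\<in>carrier G. \<forall>N\<in>null_sets M. \<phi> g ` N \<in> null_sets M)"

definition is_domain :: "'a measure \<Rightarrow> 'a set \<Rightarrow> bool" where
  "is_domain M Y \<longleftrightarrow> Y \<in> sets M \<and> 0 < emeasure M Y \<and> emeasure M Y < \<infinity>"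

definition exhaustion :: "'a measure \<Rightarrow> 'a set \<Rightarrow> (nat \<Rightarrow> 'a set) \<Rightarrow> bool" where
  "exhaustion M Y Z \<longleftrightarrow>
     (\<forall>n. Z n \<in> sets M \<and> Z n \<subseteq> Y) \<and> incseq Z \<and> Y - (\<Union>n. Z n) \<in> null_sets M"

definition finite_symmetric :: "('g, 'h) monoid_scheme \<Rightarrow> 'g set \<Rightarrow> bool" where
  "finite_symmetric G S \<longleftrightarrow> finite S \<and> S \<subseteq> carrier G \<and> (\<lambda>s. inv\<^bsub>G\<^esub> s) ` S = S"

definition asymptotically_expanding ::
  "('g, 'h) monoid_scheme \<Rightarrow> 'a measure \<Rightarrow> ('g \<Rightarrow> 'a \<Rightarrow> 'a) \<Rightarrow> bool" where
  "asymptotically_expanding G M \<phi> \<longleftrightarrow>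
     (\<forall>\<alpha>::real. 0 < \<alpha> \<and> \<alpha> \<le> 1/2 \<longrightarrow>
        (\<exists>c::real. \<exists>S. c > 0 \<and> finite_symmetric G S \<and>
           (\<forall>A\<in>sets M. \<alpha> \<le> measure M A \<and> measure M A \<le> 1/2 \<longrightarrow>
              measure M (\<Union>s\<in>S. \<phi> s ` A) > (1 + c) * measure M A)))"

(* RN_deriv M N is dN/dM. The derivative is finite almost everywhere and determined only up to
   null sets; no notion below depends on the version chosen. *)
definition rn_cocycle ::
  "('g, 'h) monoid_scheme \<Rightarrow> 'a measure \<Rightarrow> ('g \<Rightarrow> 'a \<Rightarrow> 'a) \<Rightarrow> 'g \<Rightarrow> 'a \<Rightarrow> real" where
  "rn_cocycle G M \<phi> g x = enn2real (RN_deriv M (distr M M (\<phi> (inv\<^bsub>G\<^esub> g))) x)"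

definition local_steps :: "('g \<Rightarrow> 'a \<Rightarrow> 'a) \<Rightarrow> 'a set \<Rightarrow> 'g set \<Rightarrow> 'a \<Rightarrow> 'g set" where
  "local_steps \<phi> Y S x = {s\<in>S. \<phi> s x \<in> Y}"

definition markov_sigma ::
  "('g, 'h) monoid_scheme \<Rightarrow> 'a measure \<Rightarrow> ('g \<Rightarrow> 'a \<Rightarrow> 'a) \<Rightarrow> 'a set \<Rightarrow> 'g set \<Rightarrow> 'a \<Rightarrow> real" where
  "markov_sigma G M \<phi> Y S x = (\<Sum>s\<in>local_steps \<phi> Y S x. sqrt (rn_cocycle G M \<phi> s x))"

(* The mass given by the measure \<Pi>(x, .) to the set B; indicator B (\<phi> s x) is the mass
   of B under the Dirac measure at \<phi> s x. *)
definition markov_kernel ::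
  "('g, 'h) monoid_scheme \<Rightarrow> 'a measure \<Rightarrow> ('g \<Rightarrow> 'a \<Rightarrow> 'a) \<Rightarrow> 'a set \<Rightarrow> 'g set \<Rightarrow> 'a \<Rightarrow> 'a set \<Rightarrow> real" where
  "markov_kernel G M \<phi> Y S x B =
     1 / markov_sigma G M \<phi> Y S x *
       (\<Sum>s\<in>local_steps \<phi> Y S x. sqrt (rn_cocycle G M \<phi> s x) * indicator B (\<phi> s x))"

definition markov_measure ::
  "('g, 'h) monoid_scheme \<Rightarrow> 'a measure \<Rightarrow> ('g \<Rightarrow> 'a \<Rightarrow> 'a) \<Rightarrow> 'a set \<Rightarrow> 'g set \<Rightarrow> 'a measure" where
  "markov_measure G M \<phi> Y S =
     density (restrict_space M Y) (\<lambda>x. ennreal (markov_sigma G M \<phi> Y S x))"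

definition markov_boundary ::
  "('g, 'h) monoid_scheme \<Rightarrow> 'a measure \<Rightarrow> ('g \<Rightarrow> 'a \<Rightarrow> 'a) \<Rightarrow> 'a set \<Rightarrow> 'g set \<Rightarrow> 'a set \<Rightarrow> ennreal" where
  "markov_boundary G M \<phi> Y S A =
     (\<integral>\<^sup>+x\<in>A. ennreal (markov_kernel G M \<phi> Y S x (Y - A)) \<partial>markov_measure G M \<phi> Y S)"

(* Taken in the extended nonnegative reals, so that the infimum of the empty set (which arises
   e.g. when Y is an atom) is infinity, as usual. *)
definition cheeger_constant ::
  "('g, 'h) monoid_scheme \<Rightarrow> 'a measure \<Rightarrow> ('g \<Rightarrow> 'a \<Rightarrow> 'a) \<Rightarrow> 'a set \<Rightarrow> 'g set \<Rightarrow> ennreal" where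
  "cheeger_constant G M \<phi> Y S =
     Inf {markov_boundary G M \<phi> Y S A / emeasure (markov_measure G M \<phi> Y S) A | A.
            A \<in> sets M \<and> A \<subseteq> Y \<and>
            0 < emeasure (markov_measure G M \<phi> Y S) A \<and>
            emeasure (markov_measure G M \<phi> Y S) A \<le> emeasure (markov_measure G M \<phi> Y S) Y / 2}"

definition domain_of_markov_S_expansion ::
  "('g, 'h) monoid_scheme \<Rightarrow> 'a measure \<Rightarrow> ('g \<Rightarrow> 'a \<Rightarrow> 'a) \<Rightarrow> 'g set \<Rightarrow> 'a set \<Rightarrow> bool" where
  "domain_of_markov_S_expansion G M \<phi> S Y \<longleftrightarrow>
     is_domain M Y \<and> finite_symmetric G S \<and> \<one>\<^bsub>G\<^esub> \<in> S \<and> cheeger_constant G M \<phi> Y S > 0"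

definition domain_of_markov_expansion ::
  "('g, 'h) monoid_scheme \<Rightarrow> 'a measure \<Rightarrow> ('g \<Rightarrow> 'a \<Rightarrow> 'a) \<Rightarrow> 'a set \<Rightarrow> bool" where
  "domain_of_markov_expansion G M \<phi> Y \<longleftrightarrow> (\<exists>S. domain_of_markov_S_expansion G M \<phi> S Y)"

end

theory Submission
  imports Defs
begin

text \<open>The Markov quantities are governed by the flows \<open>\<integral>\<^sub>D sqrt (r s x) d\<nu>\<close>, where \<open>D\<close>
consists of the points of \<open>A\<close> that \<open>s\<close> moves into \<open>B\<close>: the normalisation \<open>\<sigma>\<close> of the kernel
cancels against the density of the Markov measure \<open>\<mu>\<close>, so that \<open>\<mu> A\<close> is the sum over \<open>s \<in> S\<close>
of the flows from \<open>A\<close> to \<open>Y\<close>, and the boundary of \<open>A\<close> is the sum of the flows from \<open>A\<close> to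
\<open>Y - A\<close>. Only two features of the square root of the cocycle matter. By the Cauchy-Schwarz
inequality, a flow is at most the square root of the measure of \<open>D\<close>, and also of the measure
of \<open>s D\<close> (\<open>flow_le_sqrt\<close>). Where \<open>r s\<close> is bounded away from \<open>0\<close> and \<open>\<infinity>\<close>, a flow is comparable
with either measure (\<open>flow_le\<close>, \<open>flow_ge\<close>).

From Markov expansion to asymptotic expansion: an exhaustion of the whole space has a member
\<open>Y\<close> missing less than \<open>\<alpha>/2\<close> of the mass. If \<open>\<alpha> \<le> \<nu> A \<le> 1/2\<close>, then both \<open>A \<inter> Y\<close> and \<open>Y - A\<close>
have measure at least \<open>\<alpha>/2\<close>, and the one with the smaller \<open>\<mu>\<close>-mass has a Markov boundary
bounded below. Both boundaries are at most \<open>card S\<close> times the square root of \<open>\<nu> (S A - A)\<close>,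
which is therefore bounded below.

From asymptotic expansion to Markov expansion: iterated expansion blows up every set of
measure at least \<open>\<alpha>\<close> to more than half of the space; two such blow-ups intersect, so that
boundedly many group elements connect any two sets of measure at least \<open>\<alpha>\<close>. Thus any two sets
that are not small have a common edge boundary that is not small (\<open>edge_boundary_large\<close>).
Inside \<open>Y\<close> one removes a maximal small set with relatively small edge boundary; by maximality
no set with relatively small boundary remains, so that the rest of \<open>Y\<close> expands with respect to
\<open>\<nu>\<close> (\<open>ex_expanding_subset\<close>). Before that, countability of the group allows the removal of a
small set off which every \<open>r s\<close> is bounded away from \<open>0\<close> and \<open>\<infinity>\<close> (\<open>ex_tame_subset\<close>); on what
is left, expansion with respect to \<open>\<nu>\<close> implies Markov expansion (\<open>tame_expanding_imp_markov\<close>).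
The sets obtained in this way need not be nested. However, both the bounds on the cocycle and
expansion with respect to \<open>\<nu>\<close> survive unions of overlapping sets (\<open>tame_Un\<close>, \<open>expanding_Un\<close>),
so that the partial unions form the required exhaustion.\<close>

section \<open>Halves of extended reals and sets of maximal measure\<close>

lemma ennreal_mean: "0 \<le> x \<Longrightarrow> 0 \<le> y \<Longrightarrow> (ennreal x + ennreal y) / 2 = ennreal ((x + y) / 2)"
  by (simp add: divide_ennreal[symmetric] ennreal_plus[symmetric] del: ennreal_plus)

lemma le_half_sum_imp_le:
  fixes a b :: ennreal
  assumes "a \<le> (a + b) / 2" "a < \<infinity>"
  shows "a \<le> b"
proof (cases "b = \<infinity>")
  case False
  then obtain x y where "a = ennreal x" "b = ennreal y" "0 \<le> x" "0 \<le> y"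
    using assms(2) by (cases a; cases b) auto
  then show ?thesis using assms(1) by (simp add: ennreal_mean)
qed simp

lemma le_half_sum_disj:
  fixes a b :: ennreal
  assumes "a < \<infinity>" "b < \<infinity>"
  shows "a \<le> (a + b) / 2 \<or> b \<le> (a + b) / 2"
proof -
  obtain x y where "a = ennreal x" "b = ennreal y" "0 \<le> x" "0 \<le> y"
    using assms by (cases a; cases b) auto
  then show ?thesis by (auto simp: ennreal_mean)
qed

text \<open>Zorn's lemma does not apply directly, because the family is closed under countable
increasing unions only. Maximality of the measure suffices: one climbs greedily, at step \<open>n\<close>
to within \<open>1 / (n + 1)\<close> of the supremum of the measures available above the current set, and
takes the union.\<close>
lemma (in finite_measure) ex_maximal_measure:
  assumes F: "F\<^sub>0 \<in> \<F>" "\<F> \<subseteq> sets M"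
    and closed: "\<And>F. (\<And>i::nat. F i \<in> \<F>) \<Longrightarrow> incseq F \<Longrightarrow> (\<Union>i. F i) \<in> \<F>"
  shows "\<exists>F\<in>\<F>. \<forall>F'\<in>\<F>. F \<subseteq> F' \<longrightarrow> measure M F' \<le> measure M F"
proof -
  have step: "\<exists>F'. F' \<in> \<F> \<and> F \<subseteq> F' \<and>
      (\<forall>F''\<in>\<F>. F \<subseteq> F'' \<longrightarrow> measure M F'' \<le> measure M F' + 1 / Suc n)" if "F \<in> \<F>" for F n
  proof -
    let ?V = "measure M ` {F''\<in>\<F>. F \<subseteq> F''}"
    have bdd: "bdd_above ?V" by (intro bdd_aboveI2[of _ _ "measure M (space M)"]) (rule bounded_measure)
    have "Sup ?V - 1 / Suc n < Sup ?V" by simp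
    moreover have "?V \<noteq> {}" using that by blast
    ultimately obtain F' where F': "F' \<in> \<F>" "F \<subseteq> F'" "Sup ?V - 1 / Suc n < measure M F'"
      using less_cSup_iff[OF _ bdd, of "Sup ?V - 1 / Suc n"] by blast
    moreover have "measure M F'' \<le> measure M F' + 1 / Suc n" if "F'' \<in> \<F>" "F \<subseteq> F''" for F''
    proof -
      have "measure M F'' \<le> Sup ?V" using that by (intro cSup_upper[OF _ bdd]) auto
      with F'(3) show ?thesis by linarith
    qed
    ultimately show ?thesis by blast
  qed
  have "\<exists>f. \<forall>n. f n \<in> \<F> \<and> (f n \<subseteq> f (Suc n) \<and>
      (\<forall>F''\<in>\<F>. f n \<subseteq> F'' \<longrightarrow> measure M F'' \<le> measure M (f (Suc n)) + 1 / Suc n))"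
    by (rule dependent_nat_choice) (use F step in blast)+
  then obtain f where f: "\<And>n. f n \<in> \<F>" "\<And>n. f n \<subseteq> f (Suc n)"
    "\<And>n F''. F'' \<in> \<F> \<Longrightarrow> f n \<subseteq> F'' \<Longrightarrow> measure M F'' \<le> measure M (f (Suc n)) + 1 / Suc n"
    by blast
  let ?U = "\<Union>i. f i"
  have U: "?U \<in> \<F>" using f by (intro closed incseq_SucI)
  have "measure M F' \<le> measure M ?U" if "F' \<in> \<F>" "?U \<subseteq> F'" for F'
  proof (rule field_le_epsilon)
    fix e :: real assume "0 < e"
    then obtain n where "1 / Suc n < e" using nat_approx_posE by blast
    moreover have "measure M F' \<le> measure M (f (Suc n)) + 1 / Suc n"
      using that by (intro f) auto
    moreover have "measure M (f (Suc n)) \<le> measure M ?U"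
      using U F by (intro finite_measure_mono) auto
    ultimately show "measure M F' \<le> measure M ?U + e" by linarith
  qed
  then show ?thesis using U by blast
qed

section \<open>The action and its Radon-Nikodym cocycle\<close>

locale nonsingular_action = prob_space M + group_action G "space M" \<phi>
  for G :: "('g, 'h) monoid_scheme" (structure) and M :: "'a measure" and \<phi> :: "'g \<Rightarrow> 'a \<Rightarrow> 'a" +
  assumes countable_group: "countable (carrier G)"
    and act_measurable: "g \<in> carrier G \<Longrightarrow> \<phi> g \<in> measurable M M"
    and act_null: "g \<in> carrier G \<Longrightarrow> N \<in> null_sets M \<Longrightarrow> \<phi> g ` N \<in> null_sets M"
begin

sublocale group G
  using group_hom by (rule group_hom.axioms(1))

abbreviation r :: "'g \<Rightarrow> 'a \<Rightarrow> real" where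
  "r \<equiv> rn_cocycle G M \<phi>"

definition sweep :: "'g set \<Rightarrow> 'a set \<Rightarrow> 'a set" where
  "sweep S A = (\<Union>s\<in>S. \<phi> s ` A)"

text \<open>The points of \<open>A\<close> with a neighbour in \<open>B\<close> together with the points of \<open>B\<close> with a
neighbour in \<open>A\<close>. Counting both sides makes the notion symmetric in \<open>A\<close> and \<open>B\<close> without any
control on how the action distorts the measure.\<close>
definition edge_boundary :: "'g set \<Rightarrow> 'a set \<Rightarrow> 'a set \<Rightarrow> 'a set" where
  "edge_boundary S A B = {x\<in>A. \<exists>s\<in>S. \<phi> s x \<in> B} \<union> {x\<in>B. \<exists>s\<in>S. \<phi> s x \<in> A}"

text \<open>For fixed \<open>Y\<close> and \<open>S\<close>, all Markov masses and Markov boundaries are sums of these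
integrals.\<close>
definition flow :: "'g \<Rightarrow> 'a set \<Rightarrow> 'a set \<Rightarrow> ennreal" where
  "flow s A B = (\<integral>\<^sup>+x. ennreal (sqrt (r s x)) * indicator {x\<in>A. \<phi> s x \<in> B} x \<partial>M)"

definition tame :: "'a set \<Rightarrow> bool" where
  "tame T \<longleftrightarrow> (\<forall>s\<in>carrier G. \<exists>K>0. \<forall>x\<in>T. 1 / K \<le> r s x \<and> r s x \<le> K)"

text \<open>A Cheeger inequality with respect to \<open>\<nu>\<close> instead of the Markov measure. The minimum on
the right replaces the restriction to sets of at most half the mass; in this form the
condition is symmetric under \<open>A \<mapsto> Z - A\<close>, and it can be transported between sets of different
mass.\<close>
definition expanding :: "'a set \<Rightarrow> bool" where
  "expanding Z \<longleftrightarrow> (\<exists>S c. finite_symmetric G S \<and> \<one> \<in> S \<and> c > 0 \<and>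
     (\<forall>A\<in>sets M. A \<subseteq> Z \<longrightarrow> prob (edge_boundary S A (Z - A)) \<ge> c * min (prob A) (prob (Z - A))))"

lemma act_closed: "g \<in> carrier G \<Longrightarrow> x \<in> space M \<Longrightarrow> \<phi> g x \<in> space M"
  using element_image by blast

lemma act_inv: "g \<in> carrier G \<Longrightarrow> x \<in> space M \<Longrightarrow> \<phi> (inv g) (\<phi> g x) = x"
  using orbit_sym_aux by blast

lemma act_inv': "g \<in> carrier G \<Longrightarrow> x \<in> space M \<Longrightarrow> \<phi> g (\<phi> (inv g) x) = x"
  using act_inv[of "inv g" x] by simp

lemma act_one: "x \<in> space M \<Longrightarrow> \<phi> \<one> x = x"
  using id_eq_one by (metis restrict_apply')

lemma step_sets [measurable]:
  assumes [measurable]: "A \<in> sets M" "B \<in> sets M" and "s \<in> carrier G"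
  shows "{x\<in>A. \<phi> s x \<in> B} \<in> sets M"
proof -
  note [measurable] = act_measurable[OF assms(3)]
  have "{x\<in>A. \<phi> s x \<in> B} = {x\<in>space M. x \<in> A \<and> \<phi> s x \<in> B}"
    using sets.sets_into_space[OF assms(1)] by auto
  then show ?thesis by simp
qed

lemma act_image_eq:
  assumes "A \<in> sets M" "s \<in> carrier G"
  shows "\<phi> s ` A = {x\<in>space M. \<phi> (inv s) x \<in> A}"
  using sets.sets_into_space[OF assms(1)] assms(2) act_closed act_inv act_inv'
  by (auto simp: image_iff) (metis)+

lemma act_image_sets:
  assumes "A \<in> sets M" "s \<in> carrier G"
  shows "\<phi> s ` A \<in> sets M"
proof -
  have [measurable]: "\<phi> (inv s) \<in> measurable M M" using assms act_measurable by simp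
  show ?thesis unfolding act_image_eq[OF assms] using assms by measurable
qed

lemma sweep_sets:
  assumes "A \<in> sets M" "S \<subseteq> carrier G" "finite S"
  shows "sweep S A \<in> sets M"
  unfolding sweep_def using assms by (auto intro!: sets.finite_UN act_image_sets)

lemma edge_boundary_sets:
  assumes "A \<in> sets M" "B \<in> sets M" "S \<subseteq> carrier G" "finite S"
  shows "edge_boundary S A B \<in> sets M"
proof -
  have eq: "{x\<in>A. \<exists>s\<in>S. \<phi> s x \<in> B} = (\<Union>s\<in>S. {x\<in>A. \<phi> s x \<in> B})" for A B
    by auto
  show ?thesis
    unfolding edge_boundary_def eq using assms
    by (intro sets.Un sets.finite_UN) (auto intro!: step_sets)
qed

lemma finite_symmetricD:
  assumes "finite_symmetric G S"
  shows "finite S" "S \<subseteq> carrier G" "s \<in> S \<Longrightarrow> inv s \<in> S"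
  using assms unfolding finite_symmetric_def by auto

text \<open>Pushed forward by the inverse of \<open>s\<close>, the measure \<open>\<nu>\<close> gives \<open>A\<close> the mass \<open>\<nu> (s A)\<close>, so
it is absolutely continuous because \<open>s\<close> preserves null sets.\<close>
lemma density_pullback:
  assumes s: "s \<in> carrier G"
  shows "density M (RN_deriv M (distr M M (\<phi> (inv s)))) = distr M M (\<phi> (inv s))"
proof (rule density_RN_deriv)
  note m = act_measurable[OF inv_closed[OF s]]
  show "absolutely_continuous M (distr M M (\<phi> (inv s)))"
    unfolding absolutely_continuous_def
  proof
    fix N assume N: "N \<in> null_sets M"
    have "\<phi> (inv s) -` N \<inter> space M = \<phi> s ` N"
      using act_image_eq[OF null_setsD2[OF N] s] by auto
    then show "N \<in> null_sets (distr M M (\<phi> (inv s)))"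
      using N act_null[OF s N] m by (auto simp: null_sets_distr_iff)
  qed
qed simp

lemma cocycle_measurable [measurable]: "r s \<in> borel_measurable M"
  unfolding rn_cocycle_def by measurable

lemma cocycle_nonneg: "0 \<le> r s x"
  unfolding rn_cocycle_def by simp

lemma cocycle_integral:
  assumes s: "s \<in> carrier G" and A: "A \<in> sets M"
  shows "(\<integral>\<^sup>+x. ennreal (r s x) * indicator A x \<partial>M) = emeasure M (\<phi> s ` A)"
proof -
  let ?N = "distr M M (\<phi> (inv s))"
  note m = act_measurable[OF inv_closed[OF s]]
  interpret N: prob_space ?N using m by (rule prob_space_distr)
  have "emeasure M (\<phi> s ` A) = emeasure ?N A"
    using act_image_eq[OF A s] A m
    by (subst emeasure_distr) (auto intro!: arg_cong[where f = "emeasure M"])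
  also have "\<dots> = (\<integral>\<^sup>+x. RN_deriv M ?N x * indicator A x \<partial>M)"
    using A by (subst density_pullback[OF s, symmetric], subst emeasure_density) auto
  also have "\<dots> = (\<integral>\<^sup>+x. ennreal (r s x) * indicator A x \<partial>M)"
  proof (rule nn_integral_cong_AE)
    have "AE x in M. RN_deriv M ?N x \<noteq> \<infinity>"
    proof (rule RN_deriv_finite)
      show "absolutely_continuous M ?N"
        using absolutely_continuousI_density[of "RN_deriv M ?N" M] density_pullback[OF s] by simp
    qed (auto simp: N.sigma_finite_measure_axioms)
    then show "AE x in M. RN_deriv M ?N x * indicator A x = ennreal (r s x) * indicator A x"
      by eventually_elim (simp add: rn_cocycle_def less_top)
  qed
  finally show ?thesis by simp
qed

text \<open>The zero set \<open>N\<close> of \<open>r s\<close> has a null image \<open>s N\<close>, and the inverse of \<open>s\<close> maps this image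
back to \<open>N\<close>.\<close>
lemma cocycle_pos:
  assumes s: "s \<in> carrier G"
  shows "AE x in M. 0 < r s x"
proof -
  let ?N = "{x\<in>space M. r s x = 0}"
  have N: "?N \<in> sets M" by measurable
  have "emeasure M (\<phi> s ` ?N) = (\<integral>\<^sup>+x. 0 \<partial>M)"
    unfolding cocycle_integral[OF s N, symmetric]
    by (intro nn_integral_cong) (auto split: split_indicator)
  then have "\<phi> s ` ?N \<in> null_sets M"
    using act_image_sets[OF N s] by (simp add: null_setsI)
  then have "\<phi> (inv s) ` (\<phi> s ` ?N) \<in> null_sets M"
    using s act_null[of "inv s"] by simp
  moreover have "\<phi> (inv s) ` (\<phi> s ` ?N) = ?N"
    using act_inv[OF s] by (force simp: image_iff)
  ultimately have "?N \<in> null_sets M" by simp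
  then show ?thesis
    by (rule AE_I') (use cocycle_nonneg[of s] in \<open>auto simp: less_le\<close>)
qed

lemma cocycle_one: "AE x in M. r \<one> x = 1"
proof -
  let ?N = "distr M M (\<phi> (inv \<one>))"
  have "?N = M"
  proof -
    have "?N = distr M M (\<lambda>x. x)"
      by (intro distr_cong) (auto simp: act_one)
    then show ?thesis by simp
  qed
  then have "AE x in M. 1 = RN_deriv M ?N x"
    by (intro RN_deriv_unique) (auto simp: density_1)
  then show ?thesis
  proof eventually_elim
    case (elim x)
    show ?case unfolding rn_cocycle_def elim[symmetric] by simp
  qed
qed

section \<open>The Markov measure and boundary as sums of flows\<close>

lemma markov_sigma_eq:
  assumes "finite S"
  shows "markov_sigma G M \<phi> Y S x = (\<Sum>s\<in>S. sqrt (r s x) * indicator Y (\<phi> s x))"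
  unfolding markov_sigma_def local_steps_def using assms
  by (intro sum.mono_neutral_cong_left) auto

text \<open>No point has to be excluded: where \<open>\<sigma>\<close> vanishes, every weight of a local step vanishes
as well.\<close>
lemma markov_sigma_times_kernel:
  assumes "finite S" "A \<subseteq> Y"
  shows "markov_sigma G M \<phi> Y S x * markov_kernel G M \<phi> Y S x (Y - A)
    = (\<Sum>s\<in>S. sqrt (r s x) * indicator (Y - A) (\<phi> s x))"
proof -
  let ?q = "\<lambda>s. sqrt (r s x) * indicator (Y - A) (\<phi> s x)"
  have k: "(\<Sum>s\<in>local_steps \<phi> Y S x. ?q s) = (\<Sum>s\<in>S. ?q s)"
    unfolding local_steps_def using assms
    by (intro sum.mono_neutral_left) auto
  show ?thesis
  proof (cases "markov_sigma G M \<phi> Y S x = 0")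
    case True
    then have "\<forall>s\<in>local_steps \<phi> Y S x. sqrt (r s x) = 0"
      unfolding markov_sigma_def using assms(1)
      by (subst (asm) sum_nonneg_eq_0_iff) (auto simp: local_steps_def cocycle_nonneg)
    then have "(\<Sum>s\<in>local_steps \<phi> Y S x. ?q s) = 0"
      by (intro sum.neutral) auto
    then show ?thesis using True k by simp
  next
    case False
    then show ?thesis unfolding markov_kernel_def k[symmetric] by simp
  qed
qed

lemma sum_flow:
  assumes S: "finite S" "S \<subseteq> carrier G" and A: "A \<in> sets M" and B: "B \<in> sets M"
  shows "(\<integral>\<^sup>+x. ennreal (\<Sum>s\<in>S. sqrt (r s x) * indicator B (\<phi> s x)) * indicator A x \<partial>M)
    = (\<Sum>s\<in>S. flow s A B)"
proof -
  have "(\<Sum>s\<in>S. flow s A B)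
    = (\<integral>\<^sup>+x. (\<Sum>s\<in>S. ennreal (sqrt (r s x)) * indicator {x\<in>A. \<phi> s x \<in> B} x) \<partial>M)"
    unfolding flow_def using S step_sets[OF A B] by (intro nn_integral_sum[symmetric]) auto
  also have "\<dots> = (\<integral>\<^sup>+x. ennreal (\<Sum>s\<in>S. sqrt (r s x) * indicator B (\<phi> s x)) * indicator A x \<partial>M)"
  proof (intro nn_integral_cong)
    fix x
    have "(\<Sum>s\<in>S. ennreal (sqrt (r s x)) * indicator {x\<in>A. \<phi> s x \<in> B} x)
      = (\<Sum>s\<in>S. ennreal (sqrt (r s x) * indicator B (\<phi> s x))) * indicator A x"
      unfolding sum_distrib_right by (intro sum.cong) (auto simp: indicator_def)
    also have "(\<Sum>s\<in>S. ennreal (sqrt (r s x) * indicator B (\<phi> s x)))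
      = ennreal (\<Sum>s\<in>S. sqrt (r s x) * indicator B (\<phi> s x))"
      by (intro sum_ennreal) (auto simp: cocycle_nonneg)
    finally show "(\<Sum>s\<in>S. ennreal (sqrt (r s x)) * indicator {x\<in>A. \<phi> s x \<in> B} x)
      = ennreal (\<Sum>s\<in>S. sqrt (r s x) * indicator B (\<phi> s x)) * indicator A x" .
  qed
  finally show ?thesis by simp
qed

lemma sum_steps_measurable:
  assumes S: "finite S" "S \<subseteq> carrier G" and B: "B \<in> sets M"
  shows "(\<lambda>x. \<Sum>s\<in>S. sqrt (r s x) * indicator B (\<phi> s x)) \<in> borel_measurable M"
proof (intro borel_measurable_sum)
  fix s assume "s \<in> S"
  then have [measurable]: "\<phi> s \<in> measurable M M" using S act_measurable by auto
  note [measurable] = B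
  show "(\<lambda>x. sqrt (r s x) * indicator B (\<phi> s x)) \<in> borel_measurable M" by measurable
qed

lemma emeasure_markov_measure:
  assumes S: "finite S" "S \<subseteq> carrier G" and Y: "Y \<in> sets M" and A: "A \<in> sets M" "A \<subseteq> Y"
  shows "emeasure (markov_measure G M \<phi> Y S) A = (\<Sum>s\<in>S. flow s A Y)"
proof -
  have [simp]: "Y \<inter> space M \<in> sets M" using Y by simp
  have m: "markov_sigma G M \<phi> Y S \<in> borel_measurable M"
    unfolding markov_sigma_eq[OF S(1), abs_def] by (rule sum_steps_measurable[OF S Y])
  have "emeasure (markov_measure G M \<phi> Y S) A
    = (\<integral>\<^sup>+x. ennreal (markov_sigma G M \<phi> Y S x) * indicator A x \<partial>restrict_space M Y)"
    unfolding markov_measure_def using A Y m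
    by (subst emeasure_density)
       (auto simp: sets_restrict_space_iff intro!: measurable_restrict_space1)
  also have "\<dots> = (\<integral>\<^sup>+x. ennreal (markov_sigma G M \<phi> Y S x) * indicator A x \<partial>M)"
    using A by (subst nn_integral_restrict_space)
       (auto intro!: nn_integral_cong split: split_indicator)
  also have "\<dots> = (\<Sum>s\<in>S. flow s A Y)"
    unfolding markov_sigma_eq[OF S(1)] by (rule sum_flow[OF S A(1) Y])
  finally show ?thesis .
qed

lemma markov_boundary_eq:
  assumes S: "finite S" "S \<subseteq> carrier G" and Y: "Y \<in> sets M" and A: "A \<in> sets M" "A \<subseteq> Y"
  shows "markov_boundary G M \<phi> Y S A = (\<Sum>s\<in>S. flow s A (Y - A))"
proof -
  have [simp]: "Y \<inter> space M \<in> sets M" using Y by simp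
  note [measurable] = A(1) Y
  have m[measurable]: "markov_sigma G M \<phi> Y S \<in> borel_measurable M"
    unfolding markov_sigma_eq[OF S(1), abs_def] by (rule sum_steps_measurable[OF S Y])
  have "(\<lambda>x. \<Sum>s\<in>local_steps \<phi> Y S x. sqrt (r s x) * indicator (Y - A) (\<phi> s x))
      = (\<lambda>x. \<Sum>s\<in>S. sqrt (r s x) * indicator (Y - A) (\<phi> s x))"
    unfolding local_steps_def using S(1)
    by (intro ext sum.mono_neutral_left) auto
  then have "(\<lambda>x. \<Sum>s\<in>local_steps \<phi> Y S x. sqrt (r s x) * indicator (Y - A) (\<phi> s x))
      \<in> borel_measurable M"
    using sum_steps_measurable[OF S, of "Y - A"] Y A by simp
  then have [measurable]: "(\<lambda>x. markov_kernel G M \<phi> Y S x (Y - A)) \<in> borel_measurable M"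
    unfolding markov_kernel_def
    by (intro borel_measurable_times borel_measurable_divide borel_measurable_const m)
  have nn: "0 \<le> markov_sigma G M \<phi> Y S x" for x
    unfolding markov_sigma_def by (intro sum_nonneg) (simp add: cocycle_nonneg)
  have "markov_boundary G M \<phi> Y S A
    = (\<integral>\<^sup>+x. ennreal (markov_sigma G M \<phi> Y S x) *
         (ennreal (markov_kernel G M \<phi> Y S x (Y - A)) * indicator A x) \<partial>restrict_space M Y)"
    unfolding markov_boundary_def markov_measure_def
    by (subst nn_integral_density) (auto intro!: measurable_restrict_space1)
  also have "\<dots> = (\<integral>\<^sup>+x. ennreal (markov_sigma G M \<phi> Y S x) *
         (ennreal (markov_kernel G M \<phi> Y S x (Y - A)) * indicator A x) \<partial>M)"
    using A by (subst nn_integral_restrict_space)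
       (auto intro!: nn_integral_cong split: split_indicator)
  also have "\<dots> = (\<integral>\<^sup>+x. ennreal (\<Sum>s\<in>S. sqrt (r s x) * indicator (Y - A) (\<phi> s x)) * indicator A x \<partial>M)"
    unfolding markov_sigma_times_kernel[OF S(1) A(2), symmetric]
    by (intro nn_integral_cong) (auto simp: ennreal_mult' nn split: split_indicator)
  also have "\<dots> = (\<Sum>s\<in>S. flow s A (Y - A))"
    using Y A by (intro sum_flow[OF S]) auto
  finally show ?thesis .
qed

section \<open>Blowing up sets under asymptotic expansion\<close>

lemma edge_boundary_commute: "edge_boundary S A B = edge_boundary S B A"
  unfolding edge_boundary_def by blast

lemma edge_boundary_mono:
  "S \<subseteq> S' \<Longrightarrow> A \<subseteq> A' \<Longrightarrow> B \<subseteq> B' \<Longrightarrow> edge_boundary S A B \<subseteq> edge_boundary S' A' B'"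
  unfolding edge_boundary_def by blast

lemma sweep_mult:
  assumes "A \<subseteq> space M" "S \<subseteq> carrier G" "T \<subseteq> carrier G"
  shows "sweep ((\<lambda>(s, t). s \<otimes> t) ` (S \<times> T)) A = sweep S (sweep T A)"
proof -
  have "\<phi> (s \<otimes> t) x = \<phi> s (\<phi> t x)" if "x \<in> A" "s \<in> S" "t \<in> T" for s t x
    using that assms by (intro composition_rule) auto
  then show ?thesis unfolding sweep_def by (force simp: image_iff)
qed

text \<open>As long as a set has measure between \<open>\<alpha>\<close> and \<open>1/2\<close>, one further multiplication by \<open>S\<close>
enlarges it by the factor \<open>1 + c\<close>. The number of multiplications needed to exceed \<open>1/2\<close>
depends on \<open>\<alpha>\<close> and \<open>c\<close> only, so that one finite set works for all \<open>A\<close>.\<close>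
lemma sweep_beyond_half:
  assumes exp: "asymptotically_expanding G M \<phi>" and \<alpha>: "0 < \<alpha>" "\<alpha> \<le> 1/2"
  shows "\<exists>T. finite T \<and> T \<subseteq> carrier G \<and> (\<forall>A\<in>sets M. \<alpha> \<le> prob A \<longrightarrow> prob (sweep T A) > 1/2)"
proof -
  obtain c S where c: "c > 0" and S: "finite S" "S \<subseteq> carrier G"
    and cS: "\<And>A. A \<in> sets M \<Longrightarrow> \<alpha> \<le> prob A \<Longrightarrow> prob A \<le> 1/2 \<Longrightarrow> prob (sweep S A) > (1 + c) * prob A"
    using exp \<alpha> finite_symmetricD unfolding asymptotically_expanding_def sweep_def by metis
  have grow: "\<exists>T. finite T \<and> T \<subseteq> carrier G \<and>
    (\<forall>A\<in>sets M. \<alpha> \<le> prob A \<longrightarrow> prob (sweep T A) > 1/2 \<or> prob (sweep T A) \<ge> (1 + c) ^ k * \<alpha>)" for k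
  proof (induction k)
    case 0
    have "sweep {\<one>} A = A" if "A \<in> sets M" for A
      using sets.sets_into_space[OF that] act_one unfolding sweep_def by (auto simp: subset_iff image_iff)
    then show ?case by (intro exI[of _ "{\<one>}"]) auto
  next
    case (Suc k)
    then obtain T where T: "finite T" "T \<subseteq> carrier G"
      and kT: "\<And>A. A \<in> sets M \<Longrightarrow> \<alpha> \<le> prob A \<Longrightarrow>
        prob (sweep T A) > 1/2 \<or> prob (sweep T A) \<ge> (1 + c) ^ k * \<alpha>"
      by blast
    \<comment> \<open>Keeping \<open>T\<close> itself ensures that sets already larger than one half do not shrink.\<close>
    define T' where "T' = T \<union> (\<lambda>(s, t). s \<otimes> t) ` (S \<times> T)"
    have T': "finite T'" "T' \<subseteq> carrier G" using S T unfolding T'_def by auto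
    have "prob (sweep T' A) > 1/2 \<or> prob (sweep T' A) \<ge> (1 + c) ^ Suc k * \<alpha>"
      if A: "A \<in> sets M" "\<alpha> \<le> prob A" for A
    proof -
      have eq: "sweep T' A = sweep T A \<union> sweep S (sweep T A)"
        using sweep_mult[OF sets.sets_into_space[OF A(1)] S(2) T(2)] unfolding T'_def
        by (auto simp: sweep_def)
      note ms = sweep_sets[OF A(1) T(2,1)] sweep_sets[OF sweep_sets[OF A(1) T(2,1)] S(2,1)]
      have le: "prob (sweep T A) \<le> prob (sweep T' A)" "prob (sweep S (sweep T A)) \<le> prob (sweep T' A)"
        unfolding eq using ms by (auto intro!: finite_measure_mono)
      show ?thesis
      proof (cases "prob (sweep T A) > 1/2")
        case False
        then have k: "(1 + c) ^ k * \<alpha> \<le> prob (sweep T A)" using kT[OF A] by simp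
        moreover have "1 * \<alpha> \<le> (1 + c) ^ k * \<alpha>" using c \<alpha> by (intro mult_right_mono one_le_power) auto
        ultimately have "(1 + c) * prob (sweep T A) < prob (sweep S (sweep T A))"
          using False by (intro cS ms) auto
        moreover have "(1 + c) * ((1 + c) ^ k * \<alpha>) \<le> (1 + c) * prob (sweep T A)"
          using k c by (intro mult_left_mono) auto
        ultimately show ?thesis using le by (simp add: mult.assoc)
      qed (use le in linarith)
    qed
    then show ?case using T' by blast
  qed
  obtain k where "1 / \<alpha> < (1 + c) ^ k" using c real_arch_pow[of "1 + c" "1 / \<alpha>"] by auto
  then have "1/2 < (1 + c) ^ k * \<alpha>" using \<alpha> by (simp add: field_simps)
  then show ?thesis using grow[of k] by (meson less_le_trans)
qed

text \<open>Let \<open>T\<close> blow up all sets of measure \<open>\<alpha> \<le> \<beta> / 2\<close> beyond one half, and let \<open>S\<close> consist of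
the products of an inverse of an element of \<open>T\<close> with an element of \<open>T\<close>. If the complement \<open>D\<close>
of \<open>S A\<close> had measure at least \<open>\<alpha>\<close>, then \<open>T D\<close> and \<open>T A\<close> would be disjoint sets each of measure
more than \<open>1/2\<close>. Hence \<open>S A\<close> misses at most half of \<open>B\<close>, and the part of \<open>B\<close> that it meets
lies in the edge boundary.\<close>
lemma edge_boundary_large:
  assumes exp: "asymptotically_expanding G M \<phi>" and \<beta>: "0 < \<beta>"
  shows "\<exists>S \<delta>. finite_symmetric G S \<and> \<one> \<in> S \<and> \<delta> > 0 \<and>
    (\<forall>A\<in>sets M. \<forall>B\<in>sets M. \<beta> \<le> prob A \<longrightarrow> \<beta> \<le> prob B \<longrightarrow> \<delta> \<le> prob (edge_boundary S A B))"
proof -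
  define \<alpha> where "\<alpha> = min (\<beta> / 2) (1 / 2)"
  have \<alpha>: "0 < \<alpha>" "\<alpha> \<le> 1/2" "\<alpha> \<le> \<beta> / 2" using \<beta> by (auto simp: \<alpha>_def)
  obtain T0 where T0: "finite T0" "T0 \<subseteq> carrier G"
    and halfT0: "\<And>A. A \<in> sets M \<Longrightarrow> \<alpha> \<le> prob A \<Longrightarrow> prob (sweep T0 A) > 1/2"
    using sweep_beyond_half[OF exp \<alpha>(1,2)] by blast
  define T where "T = insert \<one> T0"
  have T: "finite T" "T \<subseteq> carrier G" "\<one> \<in> T" using T0 by (auto simp: T_def)
  have half: "prob (sweep T A) > 1/2" if "A \<in> sets M" "\<alpha> \<le> prob A" for A
  proof -
    have "prob (sweep T0 A) \<le> prob (sweep T A)"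
      using sweep_sets[OF that(1) T(2,1)] by (intro finite_measure_mono) (auto simp: T_def sweep_def)
    then show ?thesis using halfT0[OF that] by simp
  qed
  define S where "S = (\<lambda>(t, u). inv t \<otimes> u) ` (T \<times> T)"
  have S: "finite S" "S \<subseteq> carrier G" "\<one> \<in> S"
    using T by (auto simp: S_def image_iff intro!: bexI[of _ \<one>])
  have invS: "inv s \<in> S" if "s \<in> S" for s
  proof -
    obtain t u where tu: "t \<in> T" "u \<in> T" "s = inv t \<otimes> u" using \<open>s \<in> S\<close> unfolding S_def by fastforce
    then have "inv s = inv u \<otimes> t" using T by (simp add: inv_mult_group subset_iff)
    then show ?thesis using tu unfolding S_def by (auto simp: image_iff)
  qed
  have sym: "finite_symmetric G S"
    unfolding finite_symmetric_def using S invS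
    by (auto simp: image_iff subset_iff) (metis inv_inv)
  have "\<beta> / 2 \<le> prob (edge_boundary S A B)"
    if A: "A \<in> sets M" "\<beta> \<le> prob A" and B: "B \<in> sets M" "\<beta> \<le> prob B" for A B
  proof -
    note Asp = sets.sets_into_space[OF A(1)]
    note mS = sweep_sets[OF A(1) S(2,1)]
    let ?D = "space M - sweep S A"
    have D: "?D \<in> sets M" using mS by auto
    have "prob ?D < \<alpha>"
    proof (rule ccontr)
      assume "\<not> prob ?D < \<alpha>"
      then have "1/2 < prob (sweep T ?D)" using half[OF D] by simp
      moreover have "1/2 < prob (sweep T A)" using half[OF A(1)] A(2) \<alpha>(3) \<beta> by simp
      moreover have "sweep T ?D \<inter> sweep T A = {}"
      proof (rule ccontr)
        assume "sweep T ?D \<inter> sweep T A \<noteq> {}"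
        then obtain t u d a where *: "t \<in> T" "u \<in> T" "d \<in> ?D" "a \<in> A" "\<phi> t d = \<phi> u a"
          unfolding sweep_def by blast
        have "d = \<phi> (inv t) (\<phi> t d)" using * T act_inv[of t d] by auto
        also have "\<dots> = \<phi> (inv t \<otimes> u) a" using * T Asp by (simp add: composition_rule subset_iff)
        finally have "d \<in> sweep S A" using * unfolding sweep_def S_def by auto
        then show False using * by auto
      qed
      then have "prob (sweep T ?D) + prob (sweep T A) = prob (sweep T ?D \<union> sweep T A)"
        using sweep_sets[OF D T(2,1)] sweep_sets[OF A(1) T(2,1)]
        by (intro finite_measure_Union[symmetric]) auto
      ultimately show False using prob_le_1[of "sweep T ?D \<union> sweep T A"] by linarith
    qed
    moreover have "prob B \<le> prob (edge_boundary S A B \<union> ?D)"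
    proof (rule finite_measure_mono)
      show "B \<subseteq> edge_boundary S A B \<union> ?D"
      proof
        fix x assume x: "x \<in> B"
        have "x \<in> edge_boundary S A B" if "x \<in> sweep S A"
        proof -
          obtain s a where sa: "s \<in> S" "a \<in> A" "x = \<phi> s a" using \<open>x \<in> sweep S A\<close> unfolding sweep_def by blast
          then have "\<phi> (inv s) x = a" using act_inv[of s a] S Asp by auto
          then show ?thesis using x sa invS[OF sa(1)] unfolding edge_boundary_def by blast
        qed
        then show "x \<in> edge_boundary S A B \<union> ?D"
          using x sets.sets_into_space[OF B(1)] by auto
      qed
      show "edge_boundary S A B \<union> ?D \<in> sets M"
        using edge_boundary_sets[OF A(1) B(1) S(2,1)] D by auto
    qed
    moreover have "prob (edge_boundary S A B \<union> ?D) \<le> prob (edge_boundary S A B) + prob ?D"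
      using edge_boundary_sets[OF A(1) B(1) S(2,1)] D by (intro measure_Un_le)
    ultimately show ?thesis using B(2) \<alpha>(3) by linarith
  qed
  then show ?thesis using sym S(3) \<beta> by (intro exI[of _ S] exI[of _ "\<beta> / 2"]) auto
qed

section \<open>Removing a maximal set with small boundary\<close>

text \<open>Consider the sets \<open>F\<close> of measure at most \<open>\<beta>\<close> whose edge boundary in \<open>Y\<close> has at most \<open>\<kappa>\<close>
times their measure, take a maximal one and put \<open>Z = Y - F\<close>. A set \<open>A\<close> that violates expansion
in \<open>Z\<close>, chosen as the smaller of the two parts, could be added to \<open>F\<close>, as boundaries are
subadditive: the only obstacle is the measure of \<open>A \<union> F\<close>. But its boundary is below \<open>\<delta>\<close> while its complement is not small, so by the gap
assumption \<open>A \<union> F\<close> has measure less than \<open>\<beta>\<close>.\<close>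
lemma ex_expanding_subset:
  assumes Y: "Y \<in> sets M" and S: "finite_symmetric G S" "\<one> \<in> S"
    and \<beta>: "0 < \<beta>" "3 * \<beta> \<le> prob Y" and \<delta>: "\<delta> > 0"
    and gap: "\<And>A B. A \<in> sets M \<Longrightarrow> B \<in> sets M \<Longrightarrow> \<beta> \<le> prob A \<Longrightarrow> \<beta> \<le> prob B \<Longrightarrow>
      \<delta> \<le> prob (edge_boundary S A B)"
  shows "\<exists>Z\<in>sets M. Z \<subseteq> Y \<and> prob (Y - Z) \<le> \<beta> \<and> expanding Z"
proof -
  note fS = finite_symmetricD[OF S(1)]
  note bS = edge_boundary_sets[OF _ _ fS(2,1)]
  \<comment> \<open>With \<open>\<kappa> < \<delta>\<close> the boundary of any set with relatively small boundary is below the gap, since \<open>\<nu>\<close> has mass 1.\<close>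
  define \<kappa> where "\<kappa> = \<delta> / 2"
  have \<kappa>: "0 < \<kappa>" "\<kappa> < \<delta>" using \<delta> by (auto simp: \<kappa>_def)
  define \<F> where "\<F> = {F\<in>sets M. F \<subseteq> Y \<and> prob F \<le> \<beta> \<and> prob (edge_boundary S F (Y - F)) \<le> \<kappa> * prob F}"
  have "\<exists>F\<in>\<F>. \<forall>F'\<in>\<F>. F \<subseteq> F' \<longrightarrow> prob F' \<le> prob F"
  proof (rule ex_maximal_measure)
    show "{} \<in> \<F>" using \<beta> by (auto simp: \<F>_def edge_boundary_def)
    show "\<F> \<subseteq> sets M" by (auto simp: \<F>_def)
    fix F :: "nat \<Rightarrow> 'a set" assume F: "\<And>i. F i \<in> \<F>" "incseq F"
    let ?U = "\<Union>i. F i"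
    have mF: "F i \<in> sets M" "F i \<subseteq> Y" "prob (F i) \<le> \<beta>"
      "prob (edge_boundary S (F i) (Y - F i)) \<le> \<kappa> * prob (F i)" for i
      using F(1)[of i] by (auto simp: \<F>_def)
    have mU: "?U \<in> sets M" using mF by auto
    have lim: "(\<lambda>i. prob (F i)) \<longlonglongrightarrow> prob ?U"
      using mF by (intro finite_Lim_measure_incseq F) auto
    \<comment> \<open>The boundaries of \<open>F i\<close> in \<open>Y\<close> are not monotone in \<open>i\<close>. Those against the fixed set \<open>Y - ?U\<close> are, and they
      are contained in the former.\<close>
    have "(\<lambda>i. prob (edge_boundary S (F i) (Y - ?U))) \<longlonglongrightarrow> prob (\<Union>i. edge_boundary S (F i) (Y - ?U))"
    proof (intro finite_Lim_measure_incseq)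
      show "range (\<lambda>i. edge_boundary S (F i) (Y - ?U)) \<subseteq> sets M"
        using mF mU Y by (auto intro!: bS)
      show "incseq (\<lambda>i. edge_boundary S (F i) (Y - ?U))"
        using incseqD[OF F(2)] by (intro monoI edge_boundary_mono) auto
    qed
    also have "(\<Union>i. edge_boundary S (F i) (Y - ?U)) = edge_boundary S ?U (Y - ?U)"
      unfolding edge_boundary_def by blast
    finally have lim2: "(\<lambda>i. prob (edge_boundary S (F i) (Y - ?U))) \<longlonglongrightarrow> prob (edge_boundary S ?U (Y - ?U))" .
    have "prob (edge_boundary S (F i) (Y - ?U)) \<le> \<kappa> * prob (F i)" for i
    proof -
      have "prob (edge_boundary S (F i) (Y - ?U)) \<le> prob (edge_boundary S (F i) (Y - F i))"
        using mF Y by (intro finite_measure_mono edge_boundary_mono bS) auto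
      then show ?thesis using mF(4)[of i] by linarith
    qed
    then have "prob (edge_boundary S ?U (Y - ?U)) \<le> \<kappa> * prob ?U"
      by (intro LIMSEQ_le[OF lim2 tendsto_mult_left[OF lim]]) auto
    moreover have "prob ?U \<le> \<beta>" using mF by (intro LIMSEQ_le_const2[OF lim]) auto
    ultimately show "?U \<in> \<F>" using mF mU by (auto simp: \<F>_def)
  qed
  then obtain F where F: "F \<in> sets M" "F \<subseteq> Y" "prob F \<le> \<beta>"
      "prob (edge_boundary S F (Y - F)) \<le> \<kappa> * prob F"
    and max: "\<And>F'. F' \<in> \<F> \<Longrightarrow> F \<subseteq> F' \<Longrightarrow> prob F' \<le> prob F"
    by (auto simp: \<F>_def)
  define Z where "Z = Y - F"
  have Z: "Z \<in> sets M" "Z \<subseteq> Y" using Y F by (auto simp: Z_def)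
  have pZ: "prob Z = prob Y - prob F" unfolding Z_def using Y F by (intro finite_measure_Diff)
  have half: "\<kappa> * prob A \<le> prob (edge_boundary S A (Z - A))"
    if A: "A \<in> sets M" "A \<subseteq> Z" "prob A \<le> prob (Z - A)" for A
  proof (rule ccontr)
    assume "\<not> ?thesis"
    then have less: "prob (edge_boundary S A (Z - A)) < \<kappa> * prob A" by simp
    then have posA: "0 < prob A" using \<kappa> le_less_trans[OF measure_nonneg less] by (simp add: zero_less_mult_iff)
    let ?F = "A \<union> F"
    have mF: "?F \<in> sets M" "?F \<subseteq> Y" using A F Z by auto
    have pF: "prob ?F = prob A + prob F" using A F by (intro finite_measure_Union) (auto simp: Z_def)
    have c: "Y - ?F = Z - A" by (auto simp: Z_def)
    have "prob (edge_boundary S ?F (Y - ?F)) \<le> prob (edge_boundary S A (Z - A) \<union> edge_boundary S F (Y - F))"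
      using A F Y Z by (intro finite_measure_mono sets.Un bS) (auto simp: edge_boundary_def Z_def)
    also have "\<dots> \<le> prob (edge_boundary S A (Z - A)) + prob (edge_boundary S F (Y - F))"
      using A F Y Z by (intro measure_Un_le bS) auto
    also have "\<dots> \<le> \<kappa> * prob ?F" using less F(4) by (simp add: pF algebra_simps)
    finally have bF: "prob (edge_boundary S ?F (Y - ?F)) \<le> \<kappa> * prob ?F" .
    also have "\<dots> \<le> \<kappa> * 1" using \<kappa> by (intro mult_left_mono) auto
    finally have "prob (edge_boundary S ?F (Y - ?F)) < \<delta>" using \<kappa> by simp
    moreover have "\<beta> \<le> prob (Y - ?F)"
    proof -
      have "prob (Z - A) = prob Z - prob A" using A Z by (intro finite_measure_Diff) auto
      then show ?thesis unfolding c using A(3) pZ F(3) \<beta> by linarith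
    qed
    ultimately have "prob ?F < \<beta>" using gap[of ?F "Y - ?F"] mF Y by force
    then have "?F \<in> \<F>" using mF bF by (auto simp: \<F>_def)
    from max[OF this] pF posA show False by auto
  qed
  have "\<kappa> * min (prob A) (prob (Z - A)) \<le> prob (edge_boundary S A (Z - A))"
    if A: "A \<in> sets M" "A \<subseteq> Z" for A
  proof (cases "prob A \<le> prob (Z - A)")
    case True
    then show ?thesis using half[OF A] by (simp add: min_def)
  next
    case False
    have "Z - (Z - A) = A" using A by auto
    then show ?thesis using half[of "Z - A"] A Z False
      by (auto simp: min_def edge_boundary_commute[of S A])
  qed
  then have "expanding Z" unfolding expanding_def using S \<kappa> by blast
  moreover have "Y - Z = F" using F by (auto simp: Z_def)
  ultimately show ?thesis using Z F by auto
qed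

section \<open>Unions of overlapping expanding sets\<close>

text \<open>If the boundary of \<open>A\<close> is small, then in each of \<open>W\<close> and \<open>Z\<close> either \<open>A\<close> or its
complement \<open>B\<close> is small. If the same one of them is small in both, then it is small in the
union. Otherwise \<open>A\<close> is small in one set and \<open>B\<close> in the other, so the overlap, which they
cover, is small as well. Its measure \<open>\<tau>\<close> being fixed, this bounds the boundary from below, and
all measures are at most \<open>1\<close>.\<close>
lemma expanding_Un:
  assumes W: "W \<in> sets M" "expanding W" and Z: "Z \<in> sets M" "expanding Z"
    and pos: "0 < prob (W \<inter> Z)"
  shows "expanding (W \<union> Z)"
proof -
  obtain S1 c1 where 1: "finite_symmetric G S1" "\<one> \<in> S1" "c1 > 0"
    "\<And>A. A \<in> sets M \<Longrightarrow> A \<subseteq> W \<Longrightarrow> c1 * min (prob A) (prob (W - A)) \<le> prob (edge_boundary S1 A (W - A))"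
    using W unfolding expanding_def by blast
  obtain S2 c2 where 2: "finite_symmetric G S2" "\<one> \<in> S2" "c2 > 0"
    "\<And>A. A \<in> sets M \<Longrightarrow> A \<subseteq> Z \<Longrightarrow> c2 * min (prob A) (prob (Z - A)) \<le> prob (edge_boundary S2 A (Z - A))"
    using Z unfolding expanding_def by blast
  define S where "S = S1 \<union> S2"
  define c where "c = min c1 c2"
  define \<tau> where "\<tau> = prob (W \<inter> Z)"
  have \<tau>: "0 < \<tau>" "\<tau> \<le> 1" using pos by (auto simp: \<tau>_def)
  have c: "0 < c" using 1 2 by (auto simp: c_def)
  have S: "finite_symmetric G S"
    using 1(1) 2(1) unfolding S_def finite_symmetric_def by (auto simp: image_Un)
  note fS = finite_symmetricD[OF S]
  note bS = edge_boundary_sets[OF _ _ fS(2,1)]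
  have "(c * \<tau> / 2) * min (prob A) (prob (W \<union> Z - A)) \<le> prob (edge_boundary S A (W \<union> Z - A))"
    if A: "A \<in> sets M" "A \<subseteq> W \<union> Z" for A
  proof -
    let ?B = "W \<union> Z - A"
    have B: "?B \<in> sets M" using A W Z by auto
    define e where "e = prob (edge_boundary S A ?B) / c"
    have part: "min (prob (A \<inter> V)) (prob (?B \<inter> V)) \<le> e"
      if V: "V \<in> sets M" "V \<subseteq> W \<union> Z" "S' \<subseteq> S" "c \<le> c'"
        "c' * min (prob (A \<inter> V)) (prob (V - A \<inter> V)) \<le> prob (edge_boundary S' (A \<inter> V) (V - A \<inter> V))"
      for V S' c'
    proof -
      have eq: "V - A \<inter> V = ?B \<inter> V" using V by auto
      have "c * min (prob (A \<inter> V)) (prob (?B \<inter> V)) \<le> c' * min (prob (A \<inter> V)) (prob (?B \<inter> V))"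
        using V by (intro mult_right_mono) auto
      also have "\<dots> \<le> prob (edge_boundary S' (A \<inter> V) (?B \<inter> V))" using V(5) unfolding eq .
      also have "\<dots> \<le> prob (edge_boundary S A ?B)"
        using V A B by (intro finite_measure_mono edge_boundary_mono bS) auto
      finally show ?thesis using c by (simp add: e_def field_simps)
    qed
    have pW: "min (prob (A \<inter> W)) (prob (?B \<inter> W)) \<le> e"
      using W A by (intro part[of W S1 c1] 1) (auto simp: S_def c_def)
    have pZ: "min (prob (A \<inter> Z)) (prob (?B \<inter> Z)) \<le> e"
      using Z A by (intro part[of Z S2 c2] 2) (auto simp: S_def c_def)
    have split: "prob C \<le> prob (C \<inter> W) + prob (C \<inter> Z)" if "C \<in> sets M" "C \<subseteq> W \<union> Z" for C
    proof -
      have "C = (C \<inter> W) \<union> (C \<inter> Z)" using that by auto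
      then show ?thesis using that W Z measure_Un_le[of "C \<inter> W" M "C \<inter> Z"] by auto
    qed
    have cross: "\<tau> \<le> prob (C \<inter> W) + prob (D \<inter> Z)"
      if "C \<in> sets M" "D \<in> sets M" "W \<union> Z \<subseteq> C \<union> D" for C D
    proof -
      have "\<tau> \<le> prob ((C \<inter> W) \<union> (D \<inter> Z))"
        unfolding \<tau>_def using that W Z by (intro finite_measure_mono) auto
      then show ?thesis using that W Z measure_Un_le[of "C \<inter> W" M "D \<inter> Z"] by auto
    qed
    have m1: "min (prob A) (prob ?B) \<le> 1" by (simp add: min_le_iff_disj)
    have e0: "0 \<le> e" using c by (simp add: e_def)
    have m0: "0 \<le> min (prob A) (prob ?B)" by simp
    have "\<tau> / 2 * min (prob A) (prob ?B) \<le> e"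
    proof -
      consider "prob (A \<inter> W) \<le> e" "prob (A \<inter> Z) \<le> e" | "prob (?B \<inter> W) \<le> e" "prob (?B \<inter> Z) \<le> e"
        | "prob (A \<inter> W) \<le> e" "prob (?B \<inter> Z) \<le> e" | "prob (?B \<inter> W) \<le> e" "prob (A \<inter> Z) \<le> e"
        using pW pZ by (auto simp: min_le_iff_disj)
      then have "min (prob A) (prob ?B) \<le> 2 * e \<or> \<tau> \<le> 2 * e"
        by cases (use split[OF A] split[OF B] cross[OF A(1) B] cross[OF B A(1)] A in auto)
      then show ?thesis
      proof
        assume "min (prob A) (prob ?B) \<le> 2 * e"
        then have "\<tau> / 2 * min (prob A) (prob ?B) \<le> 1 / 2 * (2 * e)"
          using \<tau> e0 m0 by (intro mult_mono) auto
        then show ?thesis by simp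
      next
        assume "\<tau> \<le> 2 * e"
        then have "\<tau> / 2 * min (prob A) (prob ?B) \<le> e * 1"
          using \<tau> e0 m0 m1 by (intro mult_mono) auto
        then show ?thesis by simp
      qed
    qed
    then show ?thesis using c by (simp add: e_def field_simps)
  qed
  then show ?thesis
    unfolding expanding_def using S 1(2) c \<tau>
    by (intro exI[of _ S] exI[of _ "c * \<tau> / 2"]) (auto simp: S_def)
qed

section \<open>Sets on which the cocycle is bounded\<close>

lemma tame_subset: "tame T \<Longrightarrow> T' \<subseteq> T \<Longrightarrow> tame T'"
  unfolding tame_def by blast

lemma interval_reciprocal_mono:
  fixes K L x :: real
  assumes "0 < K" "K \<le> L" "1 / K \<le> x \<and> x \<le> K"
  shows "1 / L \<le> x \<and> x \<le> L"
proof -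
  have "1 / L \<le> 1 / K" using assms by (intro divide_left_mono) auto
  then show ?thesis using assms by linarith
qed

lemma tame_Un:
  assumes "tame T" "tame T'"
  shows "tame (T \<union> T')"
  unfolding tame_def
proof
  fix s assume s: "s \<in> carrier G"
  obtain K where K: "0 < K" "\<And>x. x \<in> T \<Longrightarrow> 1 / K \<le> r s x \<and> r s x \<le> K"
    using assms(1) s unfolding tame_def by blast
  obtain K' where K': "0 < K'" "\<And>x. x \<in> T' \<Longrightarrow> 1 / K' \<le> r s x \<and> r s x \<le> K'"
    using assms(2) s unfolding tame_def by blast
  have "1 / max K K' \<le> r s x \<and> r s x \<le> max K K'" if "x \<in> T \<union> T'" for x
    using that interval_reciprocal_mono[OF K(1) _ K(2), of "max K K'" x]
      interval_reciprocal_mono[OF K'(1) _ K'(2), of "max K K'" x] by auto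
  then show "\<exists>K>0. \<forall>x\<in>T \<union> T'. 1 / K \<le> r s x \<and> r s x \<le> K"
    using K(1) by (intro exI[of _ "max K K'"]) auto
qed

lemma tame_uniform:
  assumes "tame T" "finite S" "S \<subseteq> carrier G"
  shows "\<exists>L>0. \<forall>s\<in>S. \<forall>x\<in>T. 1 / L \<le> r s x \<and> r s x \<le> L"
proof -
  have "\<forall>s\<in>S. \<exists>K. 0 < K \<and> (\<forall>x\<in>T. 1 / K \<le> r s x \<and> r s x \<le> K)"
    using assms unfolding tame_def by blast
  from bchoice[OF this] obtain K where K: "\<And>s. s \<in> S \<Longrightarrow> 0 < K s"
      "\<And>s x. s \<in> S \<Longrightarrow> x \<in> T \<Longrightarrow> 1 / K s \<le> r s x \<and> r s x \<le> K s"
    by blast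
  let ?L = "1 + (\<Sum>s\<in>S. K s)"
  have K_le: "K s \<le> ?L" if "s \<in> S" for s
  proof -
    have "K s \<le> sum K S" using that K(1) assms(2) by (intro member_le_sum) (auto simp: less_imp_le)
    then show ?thesis by simp
  qed
  have "0 < ?L" using K(1) by (intro add_pos_nonneg sum_nonneg) (auto intro: less_imp_le)
  moreover have "1 / ?L \<le> r s x \<and> r s x \<le> ?L" if "s \<in> S" "x \<in> T" for s x
    using that by (intro interval_reciprocal_mono[OF K(1) K_le K(2)])
  ultimately show ?thesis by (intro exI[of _ ?L]) auto
qed

text \<open>The sets where \<open>r s\<close> leaves \<open>[1/k, k]\<close> decrease to the zero set of \<open>r s\<close>, which is
null.\<close>
lemma cocycle_bounded_off_small_set:
  assumes s: "s \<in> carrier G" and e: "0 < \<epsilon>"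
  shows "\<exists>K>0. prob {x\<in>space M. \<not> (1 / K \<le> r s x \<and> r s x \<le> K)} < \<epsilon>"
proof -
  define N where "N k = {x\<in>space M. \<not> (1 / Suc k \<le> r s x \<and> r s x \<le> Suc k)}" for k
  have N: "N k \<in> sets M" for k unfolding N_def by measurable
  have "decseq N"
  proof (rule decseq_SucI)
    fix k show "N (Suc k) \<subseteq> N k"
      using interval_reciprocal_mono[of "Suc k" "Suc (Suc k)"] unfolding N_def by auto
  qed
  then have lim: "(\<lambda>k. prob (N k)) \<longlonglongrightarrow> prob (\<Inter>k. N k)"
    using N by (intro finite_Lim_measure_decseq) auto
  have "AE x in M. x \<notin> (\<Inter>k. N k)"
    using cocycle_pos[OF s]
  proof eventually_elim
    case (elim x)
    obtain k where k: "1 / r s x + r s x < real k" using reals_Archimedean2 by blast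
    have p: "0 < 1 / r s x" using elim by simp
    have "1 / Suc k \<le> 1 / (1 / r s x)" using k p elim by (intro divide_left_mono) auto
    moreover have "r s x \<le> real k" using k p by linarith
    ultimately show ?case by (auto simp: N_def intro!: exI[of _ k])
  qed
  then have "prob (\<Inter>k. N k) = 0"
    using N by (subst prob_eq_0) auto
  with lim have "eventually (\<lambda>k. prob (N k) < \<epsilon>) sequentially"
    using e by (intro order_tendstoD) auto
  then obtain k where "prob (N k) < \<epsilon>" by (auto simp: eventually_sequentially)
  then show ?thesis unfolding N_def by (intro exI[of _ "real (Suc k)"]) auto
qed

text \<open>Enumerate the group and spend \<open>\<epsilon> / 2 ^ (n + 1)\<close> on its \<open>n\<close>-th element.\<close>
lemma ex_tame_subset:
  assumes Y: "Y \<in> sets M" and e: "0 < \<epsilon>"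
  shows "\<exists>Y'\<in>sets M. Y' \<subseteq> Y \<and> tame Y' \<and> prob (Y - Y') \<le> \<epsilon>"
proof -
  define g where "g = from_nat_into (carrier G)"
  have ne: "carrier G \<noteq> {}" by auto
  have g: "g n \<in> carrier G" for n unfolding g_def using ne by (rule from_nat_into)
  have "\<exists>K>0. prob {x\<in>space M. \<not> (1 / K \<le> r (g n) x \<and> r (g n) x \<le> K)} < \<epsilon> * (1/2) ^ Suc n" for n
    using e by (intro cocycle_bounded_off_small_set g) auto
  then have "\<exists>K. \<forall>n. 0 < K n \<and>
      prob {x\<in>space M. \<not> (1 / K n \<le> r (g n) x \<and> r (g n) x \<le> K n)} < \<epsilon> * (1/2) ^ Suc n"
    by (intro choice) blast
  then obtain K where K: "\<And>n. 0 < K n"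
      "\<And>n. prob {x\<in>space M. \<not> (1 / K n \<le> r (g n) x \<and> r (g n) x \<le> K n)} < \<epsilon> * (1/2) ^ Suc n"
    by blast
  define N where "N n = {x\<in>space M. \<not> (1 / K n \<le> r (g n) x \<and> r (g n) x \<le> K n)}" for n
  have N: "N n \<in> sets M" for n unfolding N_def by measurable
  have sums: "(\<lambda>n. \<epsilon> * (1/2) ^ Suc n) sums (\<epsilon> * 1)"
    by (intro sums_mult power_half_series)
  have pN: "prob (N n) \<le> \<epsilon> * (1/2) ^ Suc n" for n using K(2)[of n] unfolding N_def by simp
  have summable: "summable (\<lambda>n. prob (N n))"
    by (rule summable_comparison_test'[OF sums_summable[OF sums], of 0]) (use pN in auto)
  have "prob (\<Union>n. N n) \<le> (\<Sum>n. prob (N n))"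
    using N by (intro finite_measure_subadditive_countably summable) auto
  also have "\<dots> \<le> (\<Sum>n. \<epsilon> * (1/2) ^ Suc n)"
    by (intro suminf_le pN summable sums_summable[OF sums])
  also have "\<dots> = \<epsilon>" using sums_unique[OF sums] by simp
  finally have small: "prob (\<Union>n. N n) \<le> \<epsilon>" .
  have "tame (Y - (\<Union>n. N n))"
    unfolding tame_def
  proof
    fix s assume "s \<in> carrier G"
    then obtain n where n: "s = g n"
      unfolding g_def using from_nat_into_surj[OF countable_group] by metis
    have "1 / K n \<le> r s x \<and> r s x \<le> K n" if "x \<in> Y - (\<Union>n. N n)" for x
      using that sets.sets_into_space[OF Y] unfolding n N_def by auto
    then show "\<exists>K>0. \<forall>x\<in>Y - (\<Union>n. N n). 1 / K \<le> r s x \<and> r s x \<le> K" using K(1) by blast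
  qed
  moreover have "prob (Y - (Y - (\<Union>n. N n))) \<le> prob (\<Union>n. N n)"
    using N by (intro finite_measure_mono) auto
  ultimately show ?thesis
    using small Y N by (intro bexI[of _ "Y - (\<Union>n. N n)"]) auto
qed

lemma ex_tame_expanding_subset:
  assumes exp: "asymptotically_expanding G M \<phi>" and Y: "Y \<in> sets M" and e: "0 < \<epsilon>" "\<epsilon> \<le> prob Y"
  shows "\<exists>Z\<in>sets M. Z \<subseteq> Y \<and> tame Z \<and> expanding Z \<and> prob (Y - Z) \<le> \<epsilon>"
proof -
  obtain Y' where Y': "Y' \<in> sets M" "Y' \<subseteq> Y" "tame Y'" "prob (Y - Y') \<le> \<epsilon> / 2"
    using ex_tame_subset[OF Y, of "\<epsilon> / 2"] e by auto
  have pY': "prob (Y - Y') = prob Y - prob Y'"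
    using Y Y' by (intro finite_measure_Diff)
  have \<beta>: "0 < \<epsilon> / 6" "3 * (\<epsilon> / 6) \<le> prob Y'" using Y'(4) pY' e by auto
  obtain S \<delta> where "finite_symmetric G S" "\<one> \<in> S" "\<delta> > 0"
    "\<And>A B. A \<in> sets M \<Longrightarrow> B \<in> sets M \<Longrightarrow> \<epsilon> / 6 \<le> prob A \<Longrightarrow> \<epsilon> / 6 \<le> prob B \<Longrightarrow>
      \<delta> \<le> prob (edge_boundary S A B)"
    using edge_boundary_large[OF exp \<beta>(1)] by blast
  from ex_expanding_subset[OF Y'(1) this(1,2) \<beta> this(3,4)]
  obtain Z where Z: "Z \<in> sets M" "Z \<subseteq> Y'" "prob (Y' - Z) \<le> \<epsilon> / 6" "expanding Z"
    by blast
  have "Y - Z = (Y - Y') \<union> (Y' - Z)" using Z Y' by auto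
  then have "prob (Y - Z) \<le> prob (Y - Y') + prob (Y' - Z)"
    using Y Y' Z by (auto intro!: measure_Un_le)
  then have "prob (Y - Z) \<le> \<epsilon>" using Y'(4) Z(3) e by linarith
  then show ?thesis using Z Y' tame_subset by blast
qed

section \<open>From expansion in measure to Markov expansion\<close>

lemma flow_le:
  assumes A: "A \<in> sets M" and L: "\<And>x. x \<in> A \<Longrightarrow> r s x \<le> L"
  shows "flow s A B \<le> ennreal (sqrt L) * emeasure M A"
proof -
  have "flow s A B \<le> (\<integral>\<^sup>+x. ennreal (sqrt L) * indicator A x \<partial>M)"
    unfolding flow_def by (intro nn_integral_mono) (auto split: split_indicator intro!: ennreal_leI L)
  also have "\<dots> = ennreal (sqrt L) * emeasure M A" using A by (rule nn_integral_cmult_indicator)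
  finally show ?thesis .
qed

text \<open>For \<open>1 / L \<le> t \<le> L\<close> the number \<open>sqrt L * sqrt t\<close> dominates both \<open>1\<close> and \<open>t\<close>, whose
integrals over a set are its measure and the measure of its image.\<close>
lemma flow_ge:
  assumes s: "s \<in> carrier G" and A: "A \<in> sets M" and B: "B \<in> sets M"
    and L: "0 < L" "\<And>x. x \<in> A \<Longrightarrow> 1 / L \<le> r s x \<and> r s x \<le> L"
  shows "emeasure M {x\<in>A. \<phi> s x \<in> B} \<le> ennreal (sqrt L) * flow s A B"
    and "emeasure M (\<phi> s ` {x\<in>A. \<phi> s x \<in> B}) \<le> ennreal (sqrt L) * flow s A B"
proof -
  let ?D = "{x\<in>A. \<phi> s x \<in> B}"
  note [measurable] = step_sets[OF A B s]
  have scale: "ennreal (sqrt L) * flow s A B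
      = (\<integral>\<^sup>+x. ennreal (sqrt L * sqrt (r s x)) * indicator ?D x \<partial>M)"
    unfolding flow_def using L(1)
    by (subst nn_integral_cmult[symmetric]) (auto simp: ennreal_mult cocycle_nonneg mult.assoc)
  have "(\<integral>\<^sup>+x. 1 * indicator ?D x \<partial>M) \<le> ennreal (sqrt L) * flow s A B"
    unfolding scale
  proof (intro nn_integral_mono)
    fix x
    have "1 \<le> sqrt L * sqrt (r s x)" if "x \<in> A"
      unfolding real_sqrt_mult[symmetric] using L(2)[OF that] L(1) by (simp add: field_simps)
    then show "1 * indicator ?D x \<le> ennreal (sqrt L * sqrt (r s x)) * indicator ?D x"
      by (auto split: split_indicator simp: ennreal_ge_1)
  qed
  then show "emeasure M ?D \<le> ennreal (sqrt L) * flow s A B" by simp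
  have "(\<integral>\<^sup>+x. ennreal (r s x) * indicator ?D x \<partial>M) \<le> ennreal (sqrt L) * flow s A B"
    unfolding scale
  proof (intro nn_integral_mono)
    fix x
    have "r s x \<le> sqrt L * sqrt (r s x)" if "x \<in> A"
    proof -
      have "sqrt (r s x) * sqrt (r s x) \<le> sqrt L * sqrt (r s x)"
        using L(2)[OF that] by (intro mult_right_mono) (auto simp: cocycle_nonneg)
      then show ?thesis by (simp add: cocycle_nonneg)
    qed
    then show "ennreal (r s x) * indicator ?D x \<le> ennreal (sqrt L * sqrt (r s x)) * indicator ?D x"
      by (auto split: split_indicator intro!: ennreal_leI)
  qed
  then show "emeasure M (\<phi> s ` ?D) \<le> ennreal (sqrt L) * flow s A B"
    unfolding cocycle_integral[OF s step_sets[OF A B s]] .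
qed

text \<open>A flow out of \<open>A\<close> controls both sides of the edge boundary: a point of \<open>B\<close> that \<open>s\<close>
moves into \<open>A\<close> is the image, under the inverse of \<open>s\<close>, of a point of \<open>A\<close> that this inverse
moves into \<open>B\<close>.\<close>
lemma edge_boundary_le_flow:
  assumes S: "finite_symmetric G S" and A: "A \<in> sets M" and B: "B \<in> sets M"
    and L: "0 < L" "\<And>s x. s \<in> S \<Longrightarrow> x \<in> A \<Longrightarrow> 1 / L \<le> r s x \<and> r s x \<le> L"
  shows "emeasure M (edge_boundary S A B) \<le> ennreal (2 * sqrt L) * (\<Sum>s\<in>S. flow s A B)"
proof -
  note fS = finite_symmetricD[OF S]
  let ?D = "\<lambda>s. {x\<in>A. \<phi> s x \<in> B}"
  have D: "?D s \<in> sets M" "\<phi> s ` ?D s \<in> sets M" if "s \<in> S" for s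
    using that fS A B by (auto intro!: step_sets act_image_sets)
  have "edge_boundary S A B \<subseteq> (\<Union>s\<in>S. ?D s \<union> \<phi> s ` ?D s)"
  proof
    fix x assume "x \<in> edge_boundary S A B"
    then consider "x \<in> (\<Union>s\<in>S. ?D s)" | s where "x \<in> B" "s \<in> S" "\<phi> s x \<in> A"
      unfolding edge_boundary_def by blast
    then show "x \<in> (\<Union>s\<in>S. ?D s \<union> \<phi> s ` ?D s)"
    proof cases
      case 2
      have "s \<in> carrier G" "x \<in> space M" using 2 fS(2) sets.sets_into_space[OF B] by auto
      then have eq: "\<phi> (inv s) (\<phi> s x) = x" by (rule act_inv)
      with 2 have "\<phi> s x \<in> ?D (inv s)" by simp
      then have "x \<in> \<phi> (inv s) ` ?D (inv s)" using eq by (metis (lifting) imageI)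
      then show ?thesis using fS(3)[OF 2(2)] by blast
    qed auto
  qed
  then have "emeasure M (edge_boundary S A B) \<le> emeasure M (\<Union>s\<in>S. ?D s \<union> \<phi> s ` ?D s)"
    using D fS by (intro emeasure_mono) auto
  also have "\<dots> \<le> (\<Sum>s\<in>S. emeasure M (?D s \<union> \<phi> s ` ?D s))"
    using D fS by (intro emeasure_subadditive_finite) auto
  also have "\<dots> \<le> (\<Sum>s\<in>S. ennreal (2 * sqrt L) * flow s A B)"
  proof (rule sum_mono)
    fix s assume s: "s \<in> S"
    have "emeasure M (?D s \<union> \<phi> s ` ?D s) \<le> emeasure M (?D s) + emeasure M (\<phi> s ` ?D s)"
      using D[OF s] by (rule emeasure_subadditive)
    also have "\<dots> \<le> ennreal (sqrt L) * flow s A B + ennreal (sqrt L) * flow s A B"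
      using s fS L A B by (intro add_mono flow_ge) auto
    also have "\<dots> = ennreal (2 * sqrt L) * flow s A B"
      using L(1) by (simp add: distrib_right[symmetric] ennreal_plus[symmetric] del: ennreal_plus)
    finally show "emeasure M (?D s \<union> \<phi> s ` ?D s) \<le> ennreal (2 * sqrt L) * flow s A B" .
  qed
  finally show ?thesis by (simp add: sum_distrib_left)
qed

text \<open>On a tame set the Markov mass is at most \<open>C\<close> times \<open>\<nu>\<close>, so a set \<open>A\<close> with at most half
of the Markov mass satisfies \<open>\<mu> A \<le> C * min (\<nu> A) (\<nu> (Z - A))\<close>, no matter which of the two
parts is larger for \<open>\<nu>\<close>. Expansion bounds the minimum by the edge boundary, and the latter is
bounded by the flows.\<close>
lemma tame_expanding_imp_markov:
  assumes Z: "Z \<in> sets M" "0 < prob Z" "tame Z" "expanding Z"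
  shows "domain_of_markov_expansion G M \<phi> Z"
proof -
  obtain S c where S: "finite_symmetric G S" "\<one> \<in> S" and c: "c > 0"
    and cS: "\<And>A. A \<in> sets M \<Longrightarrow> A \<subseteq> Z \<Longrightarrow>
      c * min (prob A) (prob (Z - A)) \<le> prob (edge_boundary S A (Z - A))"
    using Z(4) unfolding expanding_def by blast
  note fS = finite_symmetricD[OF S(1)]
  obtain L where L: "0 < L" "\<And>s x. s \<in> S \<Longrightarrow> x \<in> Z \<Longrightarrow> 1 / L \<le> r s x \<and> r s x \<le> L"
    using tame_uniform[OF Z(3) fS(1,2)] by blast
  let ?\<mu> = "markov_measure G M \<phi> Z S"
  define C where "C = real (card S) * sqrt L"
  have cardS: "0 < card S" using fS(1) S(2) by (auto simp: card_gt_0_iff)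
  then have C: "0 < C" using L(1) by (simp add: C_def)
  define \<kappa> where "\<kappa> = c / (C * (2 * sqrt L))"
  have \<kappa>: "0 < \<kappa>" using c C L(1) by (simp add: \<kappa>_def)
  have \<mu>_le: "emeasure ?\<mu> A \<le> ennreal (C * prob A)" if "A \<in> sets M" "A \<subseteq> Z" for A
  proof -
    have "emeasure ?\<mu> A = (\<Sum>s\<in>S. flow s A Z)"
      using that Z fS by (intro emeasure_markov_measure) auto
    also have "\<dots> \<le> (\<Sum>s\<in>S. ennreal (sqrt L) * emeasure M A)"
      using that Z fS L by (intro sum_mono flow_le) auto
    also have "\<dots> = ennreal (C * prob A)"
      using L(1) by (simp add: C_def emeasure_eq_measure ennreal_mult mult.assoc ennreal_of_nat_eq_real_of_nat)
    finally show ?thesis .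
  qed
  have bound: "ennreal \<kappa> \<le> markov_boundary G M \<phi> Z S A / emeasure ?\<mu> A"
    if A: "A \<in> sets M" "A \<subseteq> Z" "0 < emeasure ?\<mu> A" "emeasure ?\<mu> A \<le> emeasure ?\<mu> Z / 2" for A
  proof -
    have B: "Z - A \<in> sets M" "Z - A \<subseteq> Z" using A Z by auto
    have fin: "emeasure ?\<mu> A < \<infinity>" using \<mu>_le[OF A(1,2)] by (simp add: le_less_trans)
    have sets\<mu>: "V \<in> sets ?\<mu>" if "V \<in> sets M" "V \<subseteq> Z" for V
      using that Z by (simp add: markov_measure_def sets_restrict_space_iff)
    have "emeasure ?\<mu> A + emeasure ?\<mu> (Z - A) = emeasure ?\<mu> (A \<union> (Z - A))"
      using A B by (intro plus_emeasure sets\<mu>) auto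
    also have "A \<union> (Z - A) = Z" using A by auto
    finally have "emeasure ?\<mu> A \<le> (emeasure ?\<mu> A + emeasure ?\<mu> (Z - A)) / 2"
      using A(4) by metis
    then have "emeasure ?\<mu> A \<le> emeasure ?\<mu> (Z - A)"
      using fin by (rule le_half_sum_imp_le)
    then have "emeasure ?\<mu> A \<le> ennreal (C * prob (Z - A))" using \<mu>_le[OF B] by (rule order_trans)
    then have "emeasure ?\<mu> A \<le> ennreal (C * min (prob A) (prob (Z - A)))"
      using \<mu>_le[OF A(1,2)] by (simp add: min_def)
    also have "\<dots> \<le> ennreal (C / c * prob (edge_boundary S A (Z - A)))"
    proof (rule ennreal_leI)
      have "C / c * (c * min (prob A) (prob (Z - A))) \<le> C / c * prob (edge_boundary S A (Z - A))"
        using C c cS[OF A(1,2)] by (intro mult_left_mono) auto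
      then show "C * min (prob A) (prob (Z - A)) \<le> C / c * prob (edge_boundary S A (Z - A))"
        using c by simp
    qed
    also have "\<dots> = ennreal (C / c) * emeasure M (edge_boundary S A (Z - A))"
      unfolding emeasure_eq_measure using C c by (intro ennreal_mult) auto
    also have "\<dots> \<le> ennreal (C / c) * (ennreal (2 * sqrt L) * markov_boundary G M \<phi> Z S A)"
      unfolding markov_boundary_eq[OF fS(1,2) Z(1) A(1,2)]
      using A B L by (intro mult_left_mono edge_boundary_le_flow S(1)) auto
    finally have le: "emeasure ?\<mu> A \<le> ennreal (1 / \<kappa>) * markov_boundary G M \<phi> Z S A"
      using C c L(1) by (simp add: \<kappa>_def mult.assoc[symmetric] ennreal_mult[symmetric])
    have "ennreal \<kappa> * emeasure ?\<mu> A \<le> ennreal \<kappa> * (ennreal (1 / \<kappa>) * markov_boundary G M \<phi> Z S A)"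
      using le by (intro mult_left_mono) auto
    also have "\<dots> = markov_boundary G M \<phi> Z S A"
      using \<kappa> by (simp add: mult.assoc[symmetric] ennreal_mult[symmetric])
    finally have "ennreal \<kappa> * emeasure ?\<mu> A / emeasure ?\<mu> A \<le> markov_boundary G M \<phi> Z S A / emeasure ?\<mu> A"
      by (rule divide_right_mono_ennreal)
    then show ?thesis using A(3) fin by (simp add: ennreal_mult_divide_eq)
  qed
  have "ennreal \<kappa> \<le> cheeger_constant G M \<phi> Z S"
    unfolding cheeger_constant_def by (intro Inf_greatest) (use bound in auto)
  then have "0 < cheeger_constant G M \<phi> Z S"
    using \<kappa> by (auto intro: less_le_trans[of _ "ennreal \<kappa>"])
  moreover have "is_domain M Z"
    unfolding is_domain_def using Z by (simp add: emeasure_eq_measure)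
  ultimately show ?thesis
    unfolding domain_of_markov_expansion_def domain_of_markov_S_expansion_def using S by blast
qed

text \<open>Each \<open>Z n\<close> misses at most a third of \<open>Y\<close>, so any two of them overlap in positive measure
and the partial unions \<open>W n\<close> stay expanding.\<close>
lemma ex_markov_exhaustion:
  assumes exp: "asymptotically_expanding G M \<phi>" and Y: "is_domain M Y"
  shows "\<exists>Z. exhaustion M Y Z \<and> (\<forall>n. domain_of_markov_expansion G M \<phi> (Z n))"
proof -
  have mY: "Y \<in> sets M" "0 < prob Y" using Y by (auto simp: is_domain_def emeasure_eq_measure)
  have "\<forall>n::nat. \<exists>Z. Z \<in> sets M \<and> Z \<subseteq> Y \<and> tame Z \<and> expanding Z \<and> prob (Y - Z) \<le> prob Y / real (n + 3)"
  proof
    fix n :: nat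
    have "0 < prob Y / real (n + 3)" "prob Y / real (n + 3) \<le> prob Y" using mY by (auto simp: field_simps)
    from ex_tame_expanding_subset[OF exp mY(1) this]
    show "\<exists>Z. Z \<in> sets M \<and> Z \<subseteq> Y \<and> tame Z \<and> expanding Z \<and> prob (Y - Z) \<le> prob Y / real (n + 3)"
      by (simp only: Bex_def)
  qed
  from choice[OF this] obtain Z where Z: "\<And>n. Z n \<in> sets M" "\<And>n. Z n \<subseteq> Y" "\<And>n. tame (Z n)" "\<And>n. expanding (Z n)"
      "\<And>n::nat. prob (Y - Z n) \<le> prob Y / real (n + 3)"
    by blast
  define W where "W n = (\<Union>i\<le>n. Z i)" for n
  have mW: "W n \<in> sets M" "W n \<subseteq> Y" for n using Z by (auto simp: W_def)
  have W_Suc: "W (Suc n) = W n \<union> Z (Suc n)" for n by (auto simp: W_def atMost_Suc)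
  have W0: "W 0 = Z 0" by (simp add: W_def)
  have Z0W: "Z 0 \<subseteq> W n" for n by (auto simp: W_def)
  have third: "prob (Y - Z n) \<le> prob Y / 3" for n
    using Z(5)[of n] mY by (elim order_trans) (intro divide_left_mono, auto)
  have pos: "0 < prob (W n \<inter> Z m)" for n m
  proof -
    have "prob Y \<le> prob ((Y - Z 0) \<union> (Y - Z m) \<union> (W n \<inter> Z m))"
      using mY Z mW Z0W[of n] by (intro finite_measure_mono) auto
    also have "\<dots> \<le> prob ((Y - Z 0) \<union> (Y - Z m)) + prob (W n \<inter> Z m)"
      using mY Z mW by (intro measure_Un_le) auto
    also have "prob ((Y - Z 0) \<union> (Y - Z m)) \<le> prob (Y - Z 0) + prob (Y - Z m)"
      using mY Z by (intro measure_Un_le) auto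
    finally show ?thesis using third[of 0] third[of m] mY by linarith
  qed
  have "tame (W n) \<and> expanding (W n)" for n
  proof (induction n)
    case 0
    then show ?case using Z by (simp add: W0)
  next
    case (Suc n)
    then show ?case unfolding W_Suc using Z mW pos by (intro conjI tame_Un expanding_Un) auto
  qed
  moreover have "0 < prob (W n)" for n
    using pos[of n 0] mW[of n] by (elim less_le_trans) (intro finite_measure_mono, auto)
  ultimately have "\<forall>n. domain_of_markov_expansion G M \<phi> (W n)"
    using mW by (intro allI tame_expanding_imp_markov) auto
  moreover have "exhaustion M Y W"
    unfolding exhaustion_def
  proof (intro conjI)
    show "incseq W" by (intro incseq_SucI) (auto simp: W_Suc)
    have "prob (Y - (\<Union>n. W n)) \<le> prob Y / real (n + 3)" for n :: nat
    proof -
      have "prob (Y - (\<Union>n. W n)) \<le> prob (Y - Z n)"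
        using mY Z by (intro finite_measure_mono) (auto simp: W_def)
      then show ?thesis using Z(5)[of n] by linarith
    qed
    moreover have "(\<lambda>n::nat. prob Y / real (n + 3)) \<longlonglongrightarrow> 0"
      using tendsto_mult_right[OF LIMSEQ_ignore_initial_segment[OF lim_inverse_n, of 3], of "prob Y"]
      by (simp add: field_simps)
    ultimately have "prob (Y - (\<Union>n. W n)) \<le> 0"
      by (intro LIMSEQ_le_const) auto
    then show "Y - (\<Union>n. W n) \<in> null_sets M"
      using mY mW by (intro null_setsI) (auto simp: emeasure_eq_measure measure_le_0_iff)
  qed (use mW in auto)
  ultimately show ?thesis by blast
qed

section \<open>From Markov expansion to asymptotic expansion\<close>

text \<open>By the Cauchy-Schwarz inequality, the square of the flow is at most the product of the
measures of \<open>D\<close> and \<open>s D\<close>, where \<open>D\<close> consists of the points of \<open>A\<close> moved into \<open>B\<close>. Hence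
smallness of either one makes the flow small, however badly the action distorts the measure.\<close>
lemma flow_le_sqrt:
  assumes s: "s \<in> carrier G" and A: "A \<in> sets M" and B: "B \<in> sets M" and P: "P \<in> sets M"
    and sub: "{x\<in>A. \<phi> s x \<in> B} \<subseteq> P \<or> \<phi> s ` {x\<in>A. \<phi> s x \<in> B} \<subseteq> P"
  shows "flow s A B \<le> ennreal (sqrt (prob P))"
proof -
  let ?D = "{x\<in>A. \<phi> s x \<in> B}"
  note D[measurable] = step_sets[OF A B s]
  have sq: "indicator ?D x ^ 2 = (indicator ?D x :: ennreal)" for x by (auto split: split_indicator)
  have "(flow s A B)\<^sup>2 = (\<integral>\<^sup>+x. (ennreal (sqrt (r s x)) * indicator ?D x) * indicator ?D x \<partial>M)\<^sup>2"
    unfolding flow_def by (intro arg_cong[where f = "\<lambda>t. t\<^sup>2"] nn_integral_cong) (auto split: split_indicator)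
  also have "\<dots> \<le> (\<integral>\<^sup>+x. (ennreal (sqrt (r s x)) * indicator ?D x)\<^sup>2 \<partial>M) * (\<integral>\<^sup>+x. (indicator ?D x)\<^sup>2 \<partial>M)"
    by (intro Cauchy_Schwarz_nn_integral) measurable
  also have "\<dots> = emeasure M (\<phi> s ` ?D) * emeasure M ?D"
    by (simp add: power_mult_distrib sq ennreal_power cocycle_nonneg cocycle_integral[OF s D])
  also have "\<dots> \<le> ennreal (prob P)"
    using sub
  proof
    assume "?D \<subseteq> P"
    then have "emeasure M (\<phi> s ` ?D) * emeasure M ?D \<le> 1 * emeasure M P"
      using P by (intro mult_mono emeasure_mono emeasure_le_1) auto
    then show ?thesis by (simp add: emeasure_eq_measure)
  next
    assume "\<phi> s ` ?D \<subseteq> P"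
    then have "emeasure M (\<phi> s ` ?D) * emeasure M ?D \<le> emeasure M P * 1"
      using P by (intro mult_mono emeasure_mono emeasure_le_1) auto
    then show ?thesis by (simp add: emeasure_eq_measure)
  qed
  also have "\<dots> = (ennreal (sqrt (prob P)))\<^sup>2" by (simp add: ennreal_power)
  finally have sq_le: "(flow s A B)\<^sup>2 \<le> (ennreal (sqrt (prob P)))\<^sup>2" .
  show ?thesis
  proof (cases "flow s A B")
    case (real x)
    then have "x\<^sup>2 \<le> (sqrt (prob P))\<^sup>2" using sq_le by (simp add: ennreal_power)
    then have "x \<le> sqrt (prob P)" by (rule power2_le_imp_le) simp
    then show ?thesis using real by (simp add: ennreal_leI del: ennreal_le_iff)
  next
    case top
    then show ?thesis using sq_le by (simp add: ennreal_power top_unique)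
  qed
qed

text \<open>The identity contributes the weight \<open>r \<one> = 1\<close> at almost every point.\<close>
lemma markov_measure_ge:
  assumes S: "finite S" "S \<subseteq> carrier G" "\<one> \<in> S" and Y: "Y \<in> sets M" and A: "A \<in> sets M" "A \<subseteq> Y"
  shows "emeasure M A \<le> emeasure (markov_measure G M \<phi> Y S) A"
proof -
  have "emeasure M A = (\<integral>\<^sup>+x. indicator A x \<partial>M)" using A by simp
  also have "\<dots> \<le> flow \<one> A Y"
    unfolding flow_def
  proof (rule nn_integral_mono_AE)
    show "AE x in M. indicator A x \<le> ennreal (sqrt (r \<one> x)) * indicator {x\<in>A. \<phi> \<one> x \<in> Y} x"
      using cocycle_one
    proof eventually_elim
      case (elim x)
      then show ?case
        using A sets.sets_into_space[OF A(1)] by (auto split: split_indicator simp: act_one subset_iff)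
    qed
  qed
  also have "\<dots> \<le> (\<Sum>s\<in>S. flow s A Y)" using S by (intro member_le_sum) auto
  also have "\<dots> = emeasure (markov_measure G M \<phi> Y S) A"
    using S Y A by (intro emeasure_markov_measure[symmetric])
  finally show ?thesis .
qed

text \<open>The sets \<open>A \<inter> Y\<close> and \<open>Y - A\<close> play symmetric roles, and the Cheeger inequality is applied
to the one with the smaller Markov mass. In either case every step across the boundary starts
or ends in \<open>S A - A\<close>.\<close>
lemma markov_exhaustion_imp_asymptotically_expanding:
  assumes ex: "exhaustion M (space M) Z" and dom: "\<And>n. domain_of_markov_expansion G M \<phi> (Z n)"
  shows "asymptotically_expanding G M \<phi>"
  unfolding asymptotically_expanding_def sweep_def[symmetric]
proof (intro allI impI)
  fix \<alpha> :: real assume \<alpha>: "0 < \<alpha> \<and> \<alpha> \<le> 1/2"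
  have mZ: "Z n \<in> sets M" for n using ex by (simp add: exhaustion_def)
  have "prob (\<Union>n. Z n) = 1"
  proof -
    have "AE x in M. x \<in> (\<Union>n. Z n)"
      using ex by (intro AE_I'[of "space M - (\<Union>n. Z n)"]) (auto simp: exhaustion_def)
    then show ?thesis using mZ by (subst prob_eq_1) auto
  qed
  moreover have "(\<lambda>n. prob (Z n)) \<longlonglongrightarrow> prob (\<Union>n. Z n)"
    using ex mZ by (intro finite_Lim_measure_incseq) (auto simp: exhaustion_def)
  ultimately have "eventually (\<lambda>n. 1 - \<alpha> / 2 < prob (Z n)) sequentially"
    using \<alpha> by (intro order_tendstoD) auto
  then obtain n where n: "1 - \<alpha> / 2 < prob (Z n)" by (auto simp: eventually_sequentially)
  define Y where "Y = Z n"
  have Y: "Y \<in> sets M" "1 - \<alpha> / 2 < prob Y" using mZ n by (auto simp: Y_def)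
  obtain S where S: "finite_symmetric G S" "\<one> \<in> S" and "0 < cheeger_constant G M \<phi> Y S"
    using dom[of n] unfolding Y_def domain_of_markov_expansion_def domain_of_markov_S_expansion_def by blast
  then obtain \<kappa> where \<kappa>: "0 < \<kappa>" "ennreal \<kappa> \<le> cheeger_constant G M \<phi> Y S"
    by (metis ennreal_less_zero_iff ennreal_cases ennreal_one_less_top ennreal_less_top less_imp_le order_refl top_greatest zero_less_one)
  note fS = finite_symmetricD[OF S(1)]
  let ?\<mu> = "markov_measure G M \<phi> Y S"
  have cardS: "0 < real (card S)" using fS(1) S(2) by (auto simp: card_gt_0_iff)
  define c where "c = (\<kappa> * \<alpha> / (2 * card S))\<^sup>2"
  have c: "0 < c" using \<kappa> \<alpha> cardS by (simp add: c_def)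
  have fin: "emeasure ?\<mu> A < \<infinity>" if "A \<in> sets M" "A \<subseteq> Y" for A
  proof -
    have "flow s A Y < \<infinity>" if "s \<in> S" for s
    proof -
      have "flow s A Y \<le> ennreal (sqrt (prob (space M)))"
        using that fS(2) Y(1) \<open>A \<in> sets M\<close> sets.sets_into_space[OF \<open>A \<in> sets M\<close>]
        by (intro flow_le_sqrt) auto
      also have "\<dots> < \<infinity>" by simp
      finally show ?thesis .
    qed
    then show ?thesis unfolding emeasure_markov_measure[OF fS(1,2) Y(1) that] using fS(1) by simp
  qed
  have lower: "c \<le> prob P"
    if A: "A \<in> sets M" "A \<subseteq> Y" "\<alpha> / 2 \<le> prob A" "emeasure ?\<mu> A \<le> emeasure ?\<mu> Y / 2"
      and P: "\<And>s. s \<in> S \<Longrightarrow> flow s A (Y - A) \<le> ennreal (sqrt (prob P))" for A P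
  proof -
    have ge: "emeasure M A \<le> emeasure ?\<mu> A"
      by (rule markov_measure_ge[OF fS(1,2) S(2) Y(1) A(1,2)])
    have "0 < emeasure M A" using A(3) \<alpha> by (simp add: emeasure_eq_measure)
    then have pos: "0 < emeasure ?\<mu> A" using ge by (rule less_le_trans)
    have "ennreal \<kappa> \<le> markov_boundary G M \<phi> Y S A / emeasure ?\<mu> A"
      using A pos by (intro order_trans[OF \<kappa>(2)]) (auto simp: cheeger_constant_def intro!: Inf_lower)
    then have "ennreal \<kappa> * emeasure ?\<mu> A \<le> markov_boundary G M \<phi> Y S A / emeasure ?\<mu> A * emeasure ?\<mu> A"
      by (intro mult_right_mono) auto
    also have "\<dots> = markov_boundary G M \<phi> Y S A"
      using pos fin[OF A(1,2)] by (simp add: ennreal_divide_times ennreal_divide_self)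
    also have "\<dots> \<le> (\<Sum>s\<in>S. ennreal (sqrt (prob P)))"
      unfolding markov_boundary_eq[OF fS(1,2) Y(1) A(1,2)] by (intro sum_mono P)
    also have "\<dots> = ennreal (card S * sqrt (prob P))"
      by (simp add: ennreal_mult ennreal_of_nat_eq_real_of_nat)
    finally have 1: "ennreal \<kappa> * emeasure ?\<mu> A \<le> ennreal (card S * sqrt (prob P))" .
    have "ennreal (\<kappa> * prob A) = ennreal \<kappa> * emeasure M A"
      unfolding emeasure_eq_measure using \<kappa> by (intro ennreal_mult) auto
    also have "\<dots> \<le> ennreal \<kappa> * emeasure ?\<mu> A" using ge by (intro mult_left_mono) auto
    finally have "ennreal (\<kappa> * prob A) \<le> ennreal (card S * sqrt (prob P))" using 1 by (rule order_trans)
    then have "\<kappa> * prob A \<le> card S * sqrt (prob P)" by (subst (asm) ennreal_le_iff) auto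
    moreover have "\<kappa> * (\<alpha> / 2) \<le> \<kappa> * prob A" using A(3) \<kappa> by (intro mult_left_mono) auto
    ultimately have "\<kappa> * \<alpha> / (2 * card S) \<le> sqrt (prob P)" using cardS by (simp add: field_simps)
    then have "c \<le> (sqrt (prob P))\<^sup>2" unfolding c_def using \<kappa> \<alpha> by (intro power_mono) auto
    then show ?thesis by simp
  qed
  have "(1 + c) * prob A < prob (sweep S A)" if A: "A \<in> sets M" "\<alpha> \<le> prob A \<and> prob A \<le> 1/2" for A
  proof -
    let ?P = "sweep S A - A" and ?A1 = "A \<inter> Y" and ?A2 = "Y - A"
    have sp: "A \<subseteq> space M" "Y \<subseteq> space M" using A Y sets.sets_into_space by auto
    have mP: "?P \<in> sets M" using sweep_sets[OF A(1) fS(2,1)] A by auto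
    have m: "?A1 \<in> sets M" "?A2 \<in> sets M" using A Y by auto
    have "prob A \<le> prob (?A1 \<union> (space M - Y))" using A Y sp by (intro finite_measure_mono) auto
    also have "\<dots> \<le> prob ?A1 + prob (space M - Y)" using A Y by (intro measure_Un_le) auto
    also have "prob (space M - Y) = 1 - prob Y" using Y by (intro prob_compl)
    finally have p1: "\<alpha> / 2 \<le> prob ?A1" using A(2) Y(2) by linarith
    have "prob Y \<le> prob (A \<union> ?A2)" using A Y by (intro finite_measure_mono) auto
    also have "\<dots> \<le> prob A + prob ?A2" using A Y by (intro measure_Un_le) auto
    finally have p2: "\<alpha> / 2 \<le> prob ?A2" using A(2) Y(2) \<alpha> by linarith
    have step_back: "x \<in> sweep S A" if "s \<in> S" "\<phi> s x \<in> A" "x \<in> space M" for s x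
    proof -
      have "\<phi> (inv s) (\<phi> s x) = x" using that fS(2) by (intro act_inv) auto
      then show ?thesis using fS(3)[OF that(1)] that(2) unfolding sweep_def by (metis UN_I imageI)
    qed
    have f1: "flow s ?A1 (Y - ?A1) \<le> ennreal (sqrt (prob ?P))" if "s \<in> S" for s
      using that fS(2) m Y mP by (intro flow_le_sqrt) (auto simp: sweep_def)
    have f2: "flow s ?A2 (Y - ?A2) \<le> ennreal (sqrt (prob ?P))" if "s \<in> S" for s
      using that fS(2) m Y mP sp by (intro flow_le_sqrt disjI1) (auto intro: step_back)
    have "emeasure ?\<mu> ?A1 + emeasure ?\<mu> ?A2 = emeasure ?\<mu> (?A1 \<union> ?A2)"
      using m Y by (intro plus_emeasure) (auto simp: markov_measure_def sets_restrict_space_iff)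
    also have "?A1 \<union> ?A2 = Y" by auto
    finally have sum: "emeasure ?\<mu> ?A1 + emeasure ?\<mu> ?A2 = emeasure ?\<mu> Y" .
    have "emeasure ?\<mu> ?A1 \<le> emeasure ?\<mu> Y / 2 \<or> emeasure ?\<mu> ?A2 \<le> emeasure ?\<mu> Y / 2"
      unfolding sum[symmetric] using fin m by (intro le_half_sum_disj) auto
    then have cP: "c \<le> prob ?P"
    proof
      assume "emeasure ?\<mu> ?A1 \<le> emeasure ?\<mu> Y / 2"
      then show ?thesis using m p1 f1 by (intro lower[of ?A1]) auto
    next
      assume "emeasure ?\<mu> ?A2 \<le> emeasure ?\<mu> Y / 2"
      then show ?thesis using m p2 f2 by (intro lower[of ?A2]) auto
    qed
    have "A \<subseteq> sweep S A" using step_back[OF S(2)] act_one sp by auto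
    then have "prob ?P = prob (sweep S A) - prob A"
      using A sweep_sets[OF A(1) fS(2,1)] by (intro finite_measure_Diff)
    moreover have "c * prob A \<le> c * (1/2)" using A c by (intro mult_left_mono) auto
    moreover have "(1 + c) * prob A = prob A + c * prob A" by (simp add: distrib_right)
    ultimately show ?thesis using cP c by linarith
  qed
  then show "\<exists>c S. 0 < c \<and> finite_symmetric G S \<and>
      (\<forall>A\<in>sets M. \<alpha> \<le> prob A \<and> prob A \<le> 1/2 \<longrightarrow> (1 + c) * prob A < prob (sweep S A))"
    using c S(1) by blast
qed

end

section \<open>The characterisation of asymptotic expansion\<close>

theorem theoremD:
  fixes G :: "('g, 'h) monoid_scheme" and M :: "'a measure" and \<phi> :: "'g \<Rightarrow> 'a \<Rightarrow> 'a"
  assumes "prob_space M"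
    and "group G" and "countable (carrier G)"
    and "measure_class_preserving_action G M \<phi>"
  shows "asymptotically_expanding G M \<phi> \<longleftrightarrow>
    (\<forall>Y. is_domain M Y \<longrightarrow>
      (\<exists>Z. exhaustion M Y Z \<and> (\<forall>n. domain_of_markov_expansion G M \<phi> (Z n))))"
proof -
  interpret nonsingular_action G M \<phi>
    using assms unfolding measure_class_preserving_action_def
    by (intro nonsingular_action.intro nonsingular_action_axioms.intro) auto
  have "is_domain M (space M)" by (simp add: is_domain_def emeasure_space_1)
  then show ?thesis
    using ex_markov_exhaustion markov_exhaustion_imp_asymptotically_expanding by blast
qed

end
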